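(* Let $G$ be a finite group and let $\mathsf{S}$ be a supercharacter theory of $G$. Let $G=N_1>N_2>\dotsb>N_s=1$ and $G=H_1>H_2>\dotsb>H_s=1$ be two $\mathsf{S}$-chief series. Then there exist a permutation $\tau$ of $\{1,2,\dotsc,s-1\}$ and group isomorphisms $\varphi_i:N_i/N_{i+1}\to H_{\tau(i)}/H_{\tau(i)+1}$ such that $\mathsf{S}_{N_i/N_{i+1}}\simeq_{\varphi_i}\mathsf{S}_{H_{\tau(i)}/H_{\tau(i)+1}}$ for each $1\le i\le s-1$.
   Context: All groups are finite. $\mathrm{Irr}(G)$ denotes the set of irreducible complex characters of $G$; for a character $\xi$, $\mathrm{Irr}(\xi)$ denotes its set of irreducible constituents. A supercharacter theory $\mathsf{S}$ of a group $G$ is a pair $(\mathcal{X}_{\mathsf{S}},\mathcal{K}_{\mathsf{S}})$, where $\mathcal{X}_{\mathsf{S}}$ is a partition of $\mathrm{Irr}(G)$ and $\mathcal{K}_{\mathsf{S}}$ is a partition of $G$ containing $\{1\}$, such that (i) $|\mathcal{K}_{\mathsf{S}}|=|\mathcal{X}_{\mathsf{S}}|$, and (ii) for each $X\in\mathcal{X}_{\mathsf{S}}$ there exists a character $\xi_X$ of $G$ such that $\mathrm{Irr}(\xi_X)\subseteq X$ and $\xi_X$ is constant on the parts of $\mathcal{K}_{\mathsf{S}}$. The parts of $\mathcal{K}_{\mathsf{S}}$ are called $\mathsf{S}$-classes (they are unions of conjugacy classes of $G$), and $\mathrm{Cl}(\mathsf{S})=\mathcal{K}_{\mathsf{S}}$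 denotes the set of $\mathsf{S}$-classes. The set of classes determines the supercharacter theory uniquely. A subgroup of $G$ is $\mathsf{S}$-normal if it is a union of $\mathsf{S}$-classes (such a subgroup is normal in $G$). If $M\le L$ are $\mathsf{S}$-normal subgroups of $G$, then $\mathsf{S}_{L/M}$ denotes the supercharacter theory of $L/M$ induced from $\mathsf{S}$: its classes are the images $\pi(K)$, under the canonical surjection $\pi:L\to L/M$, of the $\mathsf{S}$-classes $K$ with $K\subseteq L$. (It is a known fact that this is a supercharacter theory of $L/M$.) A supercharacter theory $\mathsf{T}$ of a group $A$ is simple if the only $\mathsf{T}$-normal subgroups of $A$ are $1$ and $A$. A series $G=N_1>N_2>\dotsb>N_r=1$ (strict inclusions) is an $\mathsf{S}$-chief series if each $N_i$ is $\mathsf{S}$-normal in $G$ and $\mathsf{S}_{N_i/N_{i+1}}$ is simple for each $1\le i\le r-1$; equivalently, it is a maximal chain in the lattice of $\mathsf{S}$-normal subgroups of $G$. Any two $\mathsf{S}$-chief series of $G$ have the same length (by the standard Jordan–Hölder theorem for modular lattices). Given a group isomorphism $\varphi:A\to B$, a supercharacter theory $\mathsf{U}$ of $A$ and a supercharacter theory $\mathsf{T}$ of $B$, we say that $\mathsf{U}$ and $\mathsf{T}$ are isomorphic via $\varphi$, written $\mathsf{U}\simeq_\varphi\mathsf{T}$, if $\mathrm{Cl}(\mathsf{T})=\{\varphi(K):K\in\mathrm{Cl}(\mathsf{U})\}$. *)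

theory Defs
  imports
    "Jordan_Normal_Form.VS_Connect"
    "HOL-Algebra.Coset"
    "HOL-Library.Disjoint_Sets"
    "HOL-Combinatorics.Permutations"
begin

text \<open>A complex representation of degree \<open>n\<close> is a homomorphism into the general linear group,
  which is the group of units of the matrix ring. Degree 0 is excluded, so that the zero
  function is not a character.\<close>

definition representation :: "('a, 'b) monoid_scheme \<Rightarrow> nat \<Rightarrow> ('a \<Rightarrow> complex mat) \<Rightarrow> bool" where
  "representation G n \<rho> \<longleftrightarrow>
     n > 0 \<and> \<rho> \<in> hom G (units_of (ring_mat TYPE(complex) n ()))"

definition irreducible_representation ::
    "('a, 'b) monoid_scheme \<Rightarrow> nat \<Rightarrow> ('a \<Rightarrow> complex mat) \<Rightarrow> bool" where
  "irreducible_representation G n \<rho> \<longleftrightarrow>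
     representation G n \<rho> \<and>
     (\<forall>W. VectorSpace.subspace class_ring W (module_vec TYPE(complex) n) \<and>
          (\<forall>g \<in> carrier G. \<forall>w \<in> W. \<rho> g *\<^sub>v w \<in> W) \<longrightarrow>
          W = {0\<^sub>v n} \<or> W = carrier_vec n)"

definition mat_trace :: "complex mat \<Rightarrow> complex" where
  "mat_trace A = (\<Sum>i<dim_row A. A $$ (i, i))"

text \<open>Characters are extensional (\<open>undefined\<close> outside the carrier), so that characters agreeing
  on the group are equal and \<open>Irr\<close> has the right cardinality.\<close>

definition afforded_character ::
    "('a, 'b) monoid_scheme \<Rightarrow> ('a \<Rightarrow> complex mat) \<Rightarrow> 'a \<Rightarrow> complex" where
  "afforded_character G \<rho> = restrict (\<lambda>g. mat_trace (\<rho> g)) (carrier G)"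

definition character :: "('a, 'b) monoid_scheme \<Rightarrow> ('a \<Rightarrow> complex) \<Rightarrow> bool" where
  "character G \<xi> \<longleftrightarrow> (\<exists>n \<rho>. representation G n \<rho> \<and> \<xi> = afforded_character G \<rho>)"

definition Irr :: "('a, 'b) monoid_scheme \<Rightarrow> ('a \<Rightarrow> complex) set" where
  "Irr G = {afforded_character G \<rho> | n \<rho>. irreducible_representation G n \<rho>}"

text \<open>\<open>\<chi>\<close> is a constituent of \<open>\<xi>\<close> when \<open>\<xi> - \<chi>\<close> is zero or a character.\<close>

definition Irr_constituents ::
    "('a, 'b) monoid_scheme \<Rightarrow> ('a \<Rightarrow> complex) \<Rightarrow> ('a \<Rightarrow> complex) set" where
  "Irr_constituents G \<xi> =
     {\<chi> \<in> Irr G. \<xi> = \<chi> \<or>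
        (\<exists>\<theta>. character G \<theta> \<and> (\<forall>g \<in> carrier G. \<xi> g = \<chi> g + \<theta> g))}"

type_synonym 'a sct = "('a \<Rightarrow> complex) set set \<times> 'a set set"

definition Cl :: "'a sct \<Rightarrow> 'a set set" where
  "Cl S = snd S"

definition supercharacter_theory :: "('a, 'b) monoid_scheme \<Rightarrow> 'a sct \<Rightarrow> bool" where
  "supercharacter_theory G S \<longleftrightarrow>
     (case S of (\<X>, \<K>) \<Rightarrow>
        partition_on (Irr G) \<X> \<and>
        partition_on (carrier G) \<K> \<and> {\<one>\<^bsub>G\<^esub>} \<in> \<K> \<and>
        card \<K> = card \<X> \<and>
        (\<forall>X \<in> \<X>. \<exists>\<xi>. character G \<xi> \<and> Irr_constituents G \<xi> \<subseteq> X \<and>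
           (\<forall>K \<in> \<K>. \<forall>g \<in> K. \<forall>h \<in> K. \<xi> g = \<xi> h)))"

definition sct_normal :: "('a, 'b) monoid_scheme \<Rightarrow> 'a sct \<Rightarrow> 'a set \<Rightarrow> bool" where
  "sct_normal G S N \<longleftrightarrow> subgroup N G \<and> (\<exists>\<C> \<subseteq> Cl S. N = \<Union>\<C>)"

abbreviation section_group ::
    "('a, 'b) monoid_scheme \<Rightarrow> 'a set \<Rightarrow> 'a set \<Rightarrow> 'a set monoid" where
  "section_group G L M \<equiv> (G\<lparr>carrier := L\<rparr>) Mod M"

definition section_classes ::
    "('a, 'b) monoid_scheme \<Rightarrow> 'a sct \<Rightarrow> 'a set \<Rightarrow> 'a set \<Rightarrow> 'a set set set" where
  "section_classes G S L M = {(\<lambda>x. M #>\<^bsub>G\<^esub> x) ` K | K. K \<in> Cl S \<and> K \<subseteq> L}"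

text \<open>The induced theory on \<open>L/M\<close> is given by its classes; the partition of \<open>Irr (L/M)\<close> is the
  one that these classes determine.\<close>

definition induced_sct ::
    "('a, 'b) monoid_scheme \<Rightarrow> 'a sct \<Rightarrow> 'a set \<Rightarrow> 'a set \<Rightarrow> 'a set sct" where
  "induced_sct G S L M =
     (THE \<X>. supercharacter_theory (section_group G L M) (\<X>, section_classes G S L M),
      section_classes G S L M)"

definition sct_simple :: "('a, 'b) monoid_scheme \<Rightarrow> 'a sct \<Rightarrow> bool" where
  "sct_simple A T \<longleftrightarrow> (\<forall>N. sct_normal A T N \<longrightarrow> N = {\<one>\<^bsub>A\<^esub>} \<or> N = carrier A)"

definition sct_chief_series ::
    "('a, 'b) monoid_scheme \<Rightarrow> 'a sct \<Rightarrow> nat \<Rightarrow> (nat \<Rightarrow> 'a set) \<Rightarrow> bool" where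
  "sct_chief_series G S r N \<longleftrightarrow>
     r \<ge> 1 \<and> N 1 = carrier G \<and> N r = {\<one>\<^bsub>G\<^esub>} \<and>
     (\<forall>i \<in> {1..r}. sct_normal G S (N i)) \<and>
     (\<forall>i \<in> {1..r - 1}. N (i + 1) \<subset> N i \<and>
        sct_simple (section_group G (N i) (N (i + 1))) (induced_sct G S (N i) (N (i + 1))))"

definition sct_iso_via :: "('a \<Rightarrow> 'c) \<Rightarrow> 'a sct \<Rightarrow> 'c sct \<Rightarrow> bool" where
  "sct_iso_via \<phi> U T \<longleftrightarrow> Cl T = {\<phi> ` K | K. K \<in> Cl U}"

end

theory Submission
  imports Defs "Jordan_Normal_Form.Spectral_Radius"
begin


text \<open>The definition of a supercharacter theory speaks about characters, whereas the Jordan-Hoelder argument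
needs two facts about superclasses: an \<open>S\<close>-normal subgroup \<open>M\<close> is normal, and the images of the
superclasses in \<open>G/M\<close> are pairwise equal or disjoint. Both come from one linear algebra statement.
The characters \<open>\<xi> X\<close> attached to the parts \<open>X\<close> have constituents in disjoint sets, so orthogonality of
the irreducible characters makes them linearly independent. There are as many of them as
superclasses, hence they span the space of all functions that are constant on superclasses
(\<open>supercharacter_basis\<close>).

Indicator functions of superclasses are thus combinations of characters, so superclasses are closed
under conjugation. Next let \<open>P f x\<close> be the sum of \<open>f\<close> over the coset \<open>xM\<close>. By Schur's lemma \<open>P\<close>
multiplies an irreducible character by \<open>|M|\<close> or by 0 (\<open>coset_sum_Irr\<close>), and the first case occurs iff
the character pairs nontrivially with the indicator function of \<open>M\<close>. Expanding that indicator
function in the \<open>\<xi> X\<close> shows that the case depends only on \<open>X\<close>. So every \<open>\<xi> X\<close> is an eigenvector of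
\<open>P\<close>, and \<open>P\<close> preserves the functions constant on superclasses (\<open>coset_sum_class_constant\<close>). Applied
to the indicator function of a superclass \<open>K\<close>, this says that the preimage of the image of \<open>K\<close> in
\<open>G/M\<close> is a union of superclasses, which is the second fact (\<open>coset_image_eq\<close>).

For the theorem itself, call \<open>N i/N (i+1)\<close> and \<open>H j/H (j+1)\<close> linked if \<open>N i \<inter> H j\<close> is not contained in
\<open>N (i+1)\<close> but \<open>N i \<inter> H (j+1)\<close> is. Every \<open>i\<close> has such a \<open>j\<close>, since \<open>N i \<inter> H j\<close> falls into \<open>N (i+1)\<close> at some
point as \<open>j\<close> grows. Simplicity of the factors forces the same two conditions with the roles of the
series exchanged (\<open>chief_factors_linked\<close>); therefore \<open>i \<mapsto> j\<close> is injective, and it is a permutation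
because the lengths agree. For linked factors \<open>Q = N i \<inter> H j\<close> meets every coset in either factor and
has the same intersection with \<open>N (i+1)\<close> and \<open>H (j+1)\<close>, so both factors are copies of \<open>Q\<close> modulo that
intersection. By the second fact the classes of either factor are the images of the superclasses
contained in \<open>Q\<close>, and the isomorphism matches them.\<close>

section \<open>Complex matrices\<close>

lemma mat_trace_mult_comm:
  assumes "A \<in> carrier_mat n m" "B \<in> carrier_mat m n"
  shows "mat_trace (A * B) = mat_trace (B * A)"
proof -
  have "mat_trace (A * B) = (\<Sum>i<n. \<Sum>j<m. A $$ (i, j) * B $$ (j, i))"
    using assms by (auto simp: mat_trace_def scalar_prod_def lessThan_atLeast0)
  also have "\<dots> = (\<Sum>j<m. \<Sum>i<n. B $$ (j, i) * A $$ (i, j))"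
    by (subst sum.swap) (simp add: mult.commute)
  also have "\<dots> = mat_trace (B * A)"
    using assms by (auto simp: mat_trace_def scalar_prod_def lessThan_atLeast0)
  finally show ?thesis .
qed

lemma mat_trace_one: "mat_trace (1\<^sub>m n) = of_nat n"
  by (simp add: mat_trace_def)

lemma index_mult_mat_sum:
  assumes "A \<in> carrier_mat n m" "B \<in> carrier_mat m p" "i < n" "j < p"
  shows "(A * B) $$ (i, j) = (\<Sum>k<m. A $$ (i, k) * B $$ (k, j))"
  using assms by (auto simp: scalar_prod_def lessThan_atLeast0)

lemma index_mult_unit_vec:
  fixes A :: "complex mat"
  assumes "A \<in> carrier_mat n m" "i < n" "j < m"
  shows "(A *\<^sub>v unit_vec m j) $ i = A $$ (i, j)"
  using assms by (simp add: row_def)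

lemma zero_mat_if_mult_vec_zero:
  fixes T :: "complex mat"
  assumes T: "T \<in> carrier_mat n m" and z: "\<And>v. v \<in> carrier_vec m \<Longrightarrow> T *\<^sub>v v = 0\<^sub>v n"
  shows "T = 0\<^sub>m n m"
proof (rule eq_matI)
  fix i j assume ij: "i < dim_row (0\<^sub>m n m :: complex mat)" "j < dim_col (0\<^sub>m n m :: complex mat)"
  have "T *\<^sub>v unit_vec m j = 0\<^sub>v n" by (rule z) simp
  moreover have "(T *\<^sub>v unit_vec m j) $ i = T $$ (i, j)"
    using T ij by (intro index_mult_unit_vec) auto
  ultimately show "T $$ (i, j) = 0\<^sub>m n m $$ (i, j)" using ij by simp
qed (use T in auto)

lemma right_inverse_if_surj:
  fixes T :: "complex mat"
  assumes T: "T \<in> carrier_mat n m" and s: "\<And>w. w \<in> carrier_vec n \<Longrightarrow> \<exists>v\<in>carrier_vec m. T *\<^sub>v v = w"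
  shows "\<exists>R\<in>carrier_mat m n. T * R = 1\<^sub>m n"
proof -
  have "\<forall>j. \<exists>v\<in>carrier_vec m. T *\<^sub>v v = unit_vec n j" using s by simp
  then obtain c where c: "\<And>j. c j \<in> carrier_vec m" "\<And>j. T *\<^sub>v c j = unit_vec n j" by metis
  define R where "R = mat_of_cols m (map c [0..<n])"
  have R: "R \<in> carrier_mat m n" by (simp add: R_def mat_of_cols_def)
  have "T * R = 1\<^sub>m n"
  proof (rule eq_matI)
    fix i j assume ij: "i < dim_row (1\<^sub>m n :: complex mat)" "j < dim_col (1\<^sub>m n :: complex mat)"
    have "(T * R) $$ (i, j) = (T *\<^sub>v c j) $ i"
      using T R ij c(1) by (simp add: R_def)
    then show "(T * R) $$ (i, j) = 1\<^sub>m n $$ (i, j)" using ij by (auto simp: c(2))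
  qed (use T R in auto)
  then show ?thesis using R by blast
qed

text \<open>A basis of \<open>W\<close> extended to a basis of the whole space gives the columns of \<open>P\<close>. In the new coordinates
\<open>W\<close> consists of the vectors supported on the first \<open>k\<close> positions, so operators preserving \<open>W\<close> become
block triangular.\<close>

lemma subspace_adapted_basis:
  fixes W :: "complex vec set"
  assumes sub: "VectorSpace.subspace class_ring W (module_vec TYPE(complex) n)"
    and W0: "W \<noteq> {0\<^sub>v n}" and W1: "W \<noteq> carrier_vec n"
  obtains k P R where "0 < k" "k < n" "P \<in> carrier_mat n n" "R \<in> carrier_mat n n"
    "P * R = 1\<^sub>m n" "R * P = 1\<^sub>m n" "\<And>j. j < k \<Longrightarrow> col P j \<in> W"
    "\<And>w i. w \<in> W \<Longrightarrow> k \<le> i \<Longrightarrow> i < n \<Longrightarrow> (R *\<^sub>v w) $ i = 0"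
proof -
  interpret vec_space "TYPE(complex)" n .
  have subm: "submodule class_ring W (module_vec TYPE(complex) n)"
    using sub by (simp add: VectorSpace.subspace_def)
  then have Wc: "W \<subseteq> carrier_vec n" and W0in: "0\<^sub>v n \<in> W"
    by (auto simp: submodule_def module_vec_simps)
  have bound: "\<And>A. A \<subseteq> carrier_vec n \<and> lin_indpt A \<Longrightarrow> finite A \<and> card A \<le> dim"
    using li_le_dim[OF fin_dim] by auto
  have empty: "lin_indpt {}" by (auto simp: lin_dep_def)
  have "\<exists>B. finite B \<and> maximal B (\<lambda>B. B \<subseteq> W \<and> lin_indpt B)"
    by (rule maximal_exists[where N = dim and B = "{}"]) (use bound Wc empty in auto)
  then obtain B where B: "finite B" "B \<subseteq> W" "lin_indpt B"
    and Bmax: "\<And>B'. B \<subseteq> B' \<Longrightarrow> B' \<subseteq> W \<Longrightarrow> lin_indpt B' \<Longrightarrow> B' = B"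
    by (auto simp: maximal_def)
  have WB: "W \<subseteq> span B"
  proof
    fix w assume w: "w \<in> W"
    show "w \<in> span B"
    proof (rule ccontr)
      assume ns: "w \<notin> span B"
      then have nB: "w \<notin> B" using in_own_span[of B] B Wc by auto
      then have "lin_indpt (B \<union> {w})"
        using lin_dep_iff_in_span[of B w] ns B Wc w by auto
      then have "B \<union> {w} = B" using Bmax[of "B \<union> {w}"] B w by auto
      then show False using nB by auto
    qed
  qed
  have "\<exists>D. finite D \<and> maximal D (\<lambda>D. B \<subseteq> D \<and> D \<subseteq> carrier_vec n \<and> lin_indpt D)"
    by (rule maximal_exists[where N = dim and B = B]) (use bound B Wc in auto)
  then obtain D where D: "finite D" "B \<subseteq> D" "D \<subseteq> carrier_vec n" "lin_indpt D"
    and Dmax: "\<And>D'. D \<subseteq> D' \<Longrightarrow> D' \<subseteq> carrier_vec n \<Longrightarrow> lin_indpt D' \<Longrightarrow> D' = D"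
    by (auto simp: maximal_def)
  have "maximal D (\<lambda>S. S \<subseteq> carrier_vec n \<and> lin_indpt S)"
    using D Dmax by (auto simp: maximal_def)
  then have basis: "basis D" using max_li_is_basis by simp
  then have cardD: "card D = n" using dim_basis[OF D(1)] dim_is_n by simp
  have spanD: "span D = carrier_vec n" using basis by (simp add: basis_def)
  obtain bs where bs: "set bs = B" "distinct bs" using finite_distinct_list[OF B(1)] by blast
  obtain cs where cs: "set cs = D - B" "distinct cs"
    using finite_distinct_list[of "D - B"] D(1) by blast
  define ws where "ws = bs @ cs"
  have ws: "set ws = D" "distinct ws" using bs cs D(2) by (auto simp: ws_def)
  have len: "length ws = n" using distinct_card[OF ws(2)] ws(1) cardD by simp
  define k where "k = length bs"
  have kn: "k \<le> n" using len by (simp add: k_def ws_def)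
  define P where "P = mat_of_cols n ws"
  have P: "P \<in> carrier_mat n n" using len by (simp add: P_def mat_of_cols_def)
  have colP: "col P j = ws ! j" if "j < n" for j
    using that len ws D(3) nth_mem[of j ws] unfolding P_def by (intro col_mat_of_cols) auto
  have surj: "\<exists>v\<in>carrier_vec n. P *\<^sub>v v = w" if "w \<in> carrier_vec n" for w
  proof -
    have "w \<in> span_list ws" using that span_list_as_span[of ws] ws D(3) spanD by simp
    then obtain c where "w = lincomb_list c ws" by (auto simp: span_list_def)
    then have "w = P *\<^sub>v vec (length ws) c"
      using lincomb_list_as_mat_mult[of ws c] ws(1) D(3) carrier_vecD by (metis P_def subsetD)
    then show ?thesis using len by auto
  qed
  obtain R where R: "R \<in> carrier_mat n n" and PR: "P * R = 1\<^sub>m n"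
    using right_inverse_if_surj[OF P surj] by blast
  have RP: "R * P = 1\<^sub>m n" by (rule mat_mult_left_right_inverse[OF P R PR])
  have k0: "0 < k"
  proof (rule ccontr)
    assume "\<not> 0 < k"
    then have "B = {}" using bs by (simp add: k_def)
    then have "W \<subseteq> {0\<^sub>v n}" using WB span_empty by simp
    then show False using W0 W0in by auto
  qed
  have "k \<noteq> n"
  proof
    assume "k = n"
    then have "B = D" using len bs ws by (simp add: k_def ws_def)
    then have "span B \<subseteq> W" using span_is_subset[of B W] subm B(2) by simp
    then show False using W1 Wc \<open>B = D\<close> spanD by auto
  qed
  then have kn': "k < n" using kn by simp
  have cW: "col P j \<in> W" if "j < k" for j
    using that kn colP[of j] bs B(2) nth_mem[of j bs] by (auto simp: ws_def k_def nth_append)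
  have zero: "(R *\<^sub>v w) $ i = 0" if w: "w \<in> W" and i: "k \<le> i" "i < n" for w i
  proof -
    have "w \<in> span_list bs" using w WB span_list_as_span[of bs] bs B(2) Wc by auto
    then obtain c where "w = lincomb_list c bs" by (auto simp: span_list_def)
    then have w_eq: "w = mat_of_cols n bs *\<^sub>v vec k c"
      using lincomb_list_as_mat_mult[of bs c] bs(1) B(2) Wc carrier_vecD
      by (metis k_def subsetD)
    define Q where "Q = mat_of_cols n bs"
    have Q: "Q \<in> carrier_mat n k" by (simp add: Q_def mat_of_cols_def k_def)
    have "R *\<^sub>v w = (R * Q) *\<^sub>v vec k c"
      using assoc_mult_mat_vec[OF R Q, of "vec k c"] w_eq by (simp add: Q_def)
    moreover have "row (R * Q) i = 0\<^sub>v k"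
    proof (rule eq_vecI)
      fix j assume "j < dim_vec (0\<^sub>v k :: complex vec)"
      then have j: "j < k" by simp
      have "col (Q) j = col P j"
        using j kn colP[of j] bs B(2) Wc nth_mem[of j bs]
        unfolding Q_def by (subst col_mat_of_cols) (auto simp: k_def ws_def nth_append)
      then have "(R * Q) $$ (i, j) = (R * P) $$ (i, j)"
        using i j kn R Q P by simp
      also have "\<dots> = 0" using i j kn by (simp add: RP)
      finally show "row (R * Q) i $ j = 0\<^sub>v k $ j"
        using i j R Q by simp
    qed (use R Q in auto)
    moreover have "((R * Q) *\<^sub>v vec k c) $ i = row (R * Q) i \<bullet> vec k c"
      using i R by (intro index_mult_mat_vec) simp
    ultimately show ?thesis by (metis scalar_prod_left_zero vec_carrier)
  qed
  show ?thesis by (rule that[OF k0 kn' P R PR RP cW zero])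
qed

section \<open>Matrix representations and Schur's lemma\<close>

lemma (in group) representation_iff:
  "representation G n \<rho> \<longleftrightarrow> 0 < n \<and> (\<forall>g\<in>carrier G. \<rho> g \<in> carrier_mat n n) \<and>
     (\<forall>g\<in>carrier G. \<forall>h\<in>carrier G. \<rho> (g \<otimes> h) = \<rho> g * \<rho> h) \<and> \<rho> \<one> = 1\<^sub>m n"
proof -
  let ?R = "ring_mat TYPE(complex) n ()"
  interpret R: ring ?R by (rule ring_mat)
  interpret U: group "units_of ?R" by (rule R.units_group)
  show ?thesis
  proof
    assume r: "representation G n \<rho>"
    then have h: "\<rho> \<in> hom G (units_of ?R)" by (simp add: representation_def)
    then interpret group_hom G "units_of ?R" \<rho>
      by unfold_locales
    have "\<rho> \<one> = 1\<^sub>m n"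
      using hom_one by (simp add: units_of_one ring_mat_simps)
    then show "0 < n \<and> (\<forall>g\<in>carrier G. \<rho> g \<in> carrier_mat n n) \<and>
     (\<forall>g\<in>carrier G. \<forall>h\<in>carrier G. \<rho> (g \<otimes> h) = \<rho> g * \<rho> h) \<and> \<rho> \<one> = 1\<^sub>m n"
      using r h
      by (auto simp: representation_def hom_def Pi_iff units_of_carrier units_of_mult ring_mat_simps Units_def)
  next
    assume r: "0 < n \<and> (\<forall>g\<in>carrier G. \<rho> g \<in> carrier_mat n n) \<and>
     (\<forall>g\<in>carrier G. \<forall>h\<in>carrier G. \<rho> (g \<otimes> h) = \<rho> g * \<rho> h) \<and> \<rho> \<one> = 1\<^sub>m n"
    have "\<rho> g \<in> Units ?R" if g: "g \<in> carrier G" for g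
    proof -
      have "\<rho> g * \<rho> (inv g) = 1\<^sub>m n" "\<rho> (inv g) * \<rho> g = 1\<^sub>m n"
        using r g by (metis inv_closed r_inv, metis inv_closed l_inv)
      then show ?thesis using r g by (auto simp: Units_def ring_mat_simps)
    qed
    then show "representation G n \<rho>"
      using r by (auto simp: representation_def hom_def units_of_carrier units_of_mult ring_mat_simps)
  qed
qed

lemma subspace_vecI:
  fixes W :: "complex vec set"
  assumes "W \<subseteq> carrier_vec n" "0\<^sub>v n \<in> W"
    and "\<And>v w. v \<in> W \<Longrightarrow> w \<in> W \<Longrightarrow> v + w \<in> W"
    and "\<And>c v. v \<in> W \<Longrightarrow> c \<cdot>\<^sub>v v \<in> W"
  shows "VectorSpace.subspace class_ring W (module_vec TYPE(complex) n)"
  unfolding VectorSpace.subspace_def submodule_def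
  using assms vec_vs[where 'a=complex] vec_module[where 'a=complex] by (auto simp: module_vec_simps)

lemma (in group) irreducible_invariant_trivial:
  assumes "irreducible_representation G n \<rho>" "W \<subseteq> carrier_vec n" "0\<^sub>v n \<in> W"
    and "\<And>v w. v \<in> W \<Longrightarrow> w \<in> W \<Longrightarrow> v + w \<in> W"
    and "\<And>c v. v \<in> W \<Longrightarrow> c \<cdot>\<^sub>v v \<in> W"
    and "\<And>g w. g \<in> carrier G \<Longrightarrow> w \<in> W \<Longrightarrow> \<rho> g *\<^sub>v w \<in> W"
  shows "W = {0\<^sub>v n} \<or> W = carrier_vec n"
  using assms(1,6) subspace_vecI[OF assms(2-5)] unfolding irreducible_representation_def by blast

text \<open>Schur's lemma: the kernel and the image of an intertwiner are invariant, so a nonzero one is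
bijective and conjugates one representation into the other. The degrees are allowed to differ, which
the two-sided inverse \<open>R\<close> makes harmless: traces of \<open>A * B\<close> and \<open>B * A\<close> agree for rectangular factors.\<close>

lemma (in group) intertwiner_imp_same_trace:
  assumes r: "irreducible_representation G n \<rho>" and s: "irreducible_representation G m \<sigma>"
    and T: "T \<in> carrier_mat n m" and tw: "\<And>g. g \<in> carrier G \<Longrightarrow> \<rho> g * T = T * \<sigma> g"
    and nz: "T \<noteq> 0\<^sub>m n m" and g: "g \<in> carrier G"
  shows "mat_trace (\<rho> g) = mat_trace (\<sigma> g)"
proof -
  have rho: "\<And>g. g \<in> carrier G \<Longrightarrow> \<rho> g \<in> carrier_mat n n"
    and sig: "\<And>g. g \<in> carrier G \<Longrightarrow> \<sigma> g \<in> carrier_mat m m"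
    using r s by (auto simp: irreducible_representation_def representation_iff)
  let ?K = "{v \<in> carrier_vec m. T *\<^sub>v v = 0\<^sub>v n}"
  let ?I = "(\<lambda>v. T *\<^sub>v v) ` carrier_vec m"
  have K: "?K = {0\<^sub>v m} \<or> ?K = carrier_vec m"
  proof (rule irreducible_invariant_trivial[OF s])
    fix g w assume gw: "g \<in> carrier G" "w \<in> ?K"
    have "T *\<^sub>v (\<sigma> g *\<^sub>v w) = \<rho> g *\<^sub>v (T *\<^sub>v w)"
      using assoc_mult_mat_vec[OF T sig, of g w] assoc_mult_mat_vec[OF rho T, of g w] tw[of g] gw by simp
    then show "\<sigma> g *\<^sub>v w \<in> ?K" using gw T mult_mat_vec_carrier[OF sig[OF gw(1)], of w] rho[OF gw(1)] by auto
  qed (use T in \<open>auto simp: mult_add_distrib_mat_vec mult_mat_vec\<close>)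
  have I: "?I = {0\<^sub>v n} \<or> ?I = carrier_vec n"
  proof (rule irreducible_invariant_trivial[OF r])
    show "0\<^sub>v n \<in> ?I" using T by (auto intro!: image_eqI[of _ _ "0\<^sub>v m"])
    fix v w assume "v \<in> ?I" "w \<in> ?I"
    then obtain a b where ab: "a \<in> carrier_vec m" "b \<in> carrier_vec m" "v = T *\<^sub>v a" "w = T *\<^sub>v b" by auto
    then have "v + w = T *\<^sub>v (a + b)" using T by (simp add: mult_add_distrib_mat_vec)
    then show "v + w \<in> ?I" using ab by auto
  next
    fix c v assume "v \<in> ?I"
    then obtain a where a: "a \<in> carrier_vec m" "v = T *\<^sub>v a" by auto
    then have "c \<cdot>\<^sub>v v = T *\<^sub>v (c \<cdot>\<^sub>v a)" using T by (simp add: mult_mat_vec)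
    then show "c \<cdot>\<^sub>v v \<in> ?I" using a by auto
  next
    fix g w assume g: "g \<in> carrier G" and w: "w \<in> ?I"
    obtain a where a: "a \<in> carrier_vec m" "w = T *\<^sub>v a" using w by auto
    have "\<rho> g *\<^sub>v w = T *\<^sub>v (\<sigma> g *\<^sub>v a)"
      using assoc_mult_mat_vec[OF T sig, of g a] assoc_mult_mat_vec[OF rho T, of g a] tw[of g] g a by simp
    then show "\<rho> g *\<^sub>v w \<in> ?I" using a sig[OF g] by auto
  qed (use T in auto)
  have "?K \<noteq> carrier_vec m"
    using nz zero_mat_if_mult_vec_zero[OF T] by auto
  with K have K0: "?K = {0\<^sub>v m}" by blast
  have "?I \<noteq> {0\<^sub>v n}"
    using nz zero_mat_if_mult_vec_zero[OF T] by auto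
  with I have "?I = carrier_vec n" by blast
  then obtain R where R: "R \<in> carrier_mat m n" and TR: "T * R = 1\<^sub>m n"
    using right_inverse_if_surj[OF T] by (metis (no_types, lifting) imageE)
  have RT: "R * T = 1\<^sub>m m"
  proof (rule eq_matI)
    fix i j assume ij: "i < dim_row (1\<^sub>m m :: complex mat)" "j < dim_col (1\<^sub>m m :: complex mat)"
    let ?v = "R *\<^sub>v (T *\<^sub>v unit_vec m j) - unit_vec m j"
    have "T *\<^sub>v (R *\<^sub>v (T *\<^sub>v unit_vec m j)) = T *\<^sub>v unit_vec m j"
      using assoc_mult_mat_vec[OF T R, of "T *\<^sub>v unit_vec m j"] T TR by simp
    then have "T *\<^sub>v ?v = 0\<^sub>v n"
      using T R by (subst mult_minus_distrib_mat_vec[of _ n m]) auto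
    then have "?v \<in> ?K" using R T by (auto intro!: minus_carrier_vec)
    then have v0: "?v = 0\<^sub>v m" using K0 by blast
    have "?v $ i = 0" using ij by (simp only: v0) simp
    then have "(R *\<^sub>v (T *\<^sub>v unit_vec m j)) $ i = unit_vec m j $ i" using ij by simp
    moreover have "R *\<^sub>v (T *\<^sub>v unit_vec m j) = (R * T) *\<^sub>v unit_vec m j"
      using R T by simp
    moreover have "((R * T) *\<^sub>v unit_vec m j) $ i = (R * T) $$ (i, j)"
      using R T ij by (intro index_mult_unit_vec) auto
    ultimately show "(R * T) $$ (i, j) = 1\<^sub>m m $$ (i, j)" using ij by simp
  qed (use R T in auto)
  have "mat_trace (\<rho> g) = mat_trace (\<rho> g * (T * R))"
    using rho[OF g] by (simp add: TR)
  also have "\<dots> = mat_trace ((T * \<sigma> g) * R)"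
    using assoc_mult_mat[OF rho[OF g] T R] tw[OF g] by simp
  also have "\<dots> = mat_trace (R * (T * \<sigma> g))"
    using T R sig[OF g] by (intro mat_trace_mult_comm) auto
  also have "R * (T * \<sigma> g) = \<sigma> g"
    using assoc_mult_mat[OF R T sig[OF g]] sig[OF g] RT by simp
  finally show ?thesis .
qed

text \<open>An eigenspace of a commuting operator is invariant and nonzero, hence everything.\<close>

lemma (in group) commuting_imp_scalar:
  assumes r: "irreducible_representation G n \<rho>"
    and T: "T \<in> carrier_mat n n" and tw: "\<And>g. g \<in> carrier G \<Longrightarrow> \<rho> g * T = T * \<rho> g"
  shows "\<exists>c. T = c \<cdot>\<^sub>m 1\<^sub>m n"
proof -
  have n: "0 < n" and rho: "\<And>g. g \<in> carrier G \<Longrightarrow> \<rho> g \<in> carrier_mat n n"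
    using r by (auto simp: irreducible_representation_def representation_iff)
  obtain c where "eigenvalue T c"
    using spectrum_non_empty[OF T n] by (auto simp: spectrum_def)
  then obtain v where v: "v \<in> carrier_vec n" "v \<noteq> 0\<^sub>v n" "T *\<^sub>v v = c \<cdot>\<^sub>v v"
    using T by (auto simp: eigenvalue_def eigenvector_def)
  let ?K = "{v \<in> carrier_vec n. T *\<^sub>v v = c \<cdot>\<^sub>v v}"
  have "?K = {0\<^sub>v n} \<or> ?K = carrier_vec n"
  proof (rule irreducible_invariant_trivial[OF r])
    fix g w assume gw: "g \<in> carrier G" "w \<in> ?K"
    have "T *\<^sub>v (\<rho> g *\<^sub>v w) = \<rho> g *\<^sub>v (T *\<^sub>v w)"
      using assoc_mult_mat_vec[OF T rho, of g w] assoc_mult_mat_vec[OF rho T, of g w] tw[of g] gw by simp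
    then show "\<rho> g *\<^sub>v w \<in> ?K" using gw rho[OF gw(1)] by (auto simp: mult_mat_vec)
  qed (use T in \<open>auto simp: mult_add_distrib_mat_vec mult_mat_vec smult_add_distrib_vec
        smult_smult_assoc mult.commute\<close>)
  moreover have "?K \<noteq> {0\<^sub>v n}" using v by auto
  ultimately have K: "?K = carrier_vec n" by blast
  have "T = c \<cdot>\<^sub>m 1\<^sub>m n"
  proof (rule eq_matI)
    fix i j assume ij: "i < dim_row (c \<cdot>\<^sub>m 1\<^sub>m n)" "j < dim_col (c \<cdot>\<^sub>m 1\<^sub>m n)"
    have "unit_vec n j \<in> ?K" unfolding K by simp
    then have "T *\<^sub>v unit_vec n j = c \<cdot>\<^sub>v unit_vec n j" by simp
    then have "(T *\<^sub>v unit_vec n j) $ i = (c \<cdot>\<^sub>v unit_vec n j) $ i" by simp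
    then show "T $$ (i, j) = (c \<cdot>\<^sub>m 1\<^sub>m n) $$ (i, j)"
      using T ij by (auto simp: row_def)
  qed (use T in auto)
  then show ?thesis ..
qed

section \<open>Characters as sums of irreducible characters\<close>

context group
begin

lemma character_class_function:
  assumes "character G \<xi>" "x \<in> carrier G" "y \<in> carrier G"
  shows "\<xi> (x \<otimes> y) = \<xi> (y \<otimes> x)"
proof -
  obtain n \<rho> where r: "representation G n \<rho>" "\<xi> = afforded_character G \<rho>"
    using assms by (auto simp: character_def)
  then show ?thesis
    using assms(2,3) mat_trace_mult_comm[of "\<rho> x" n n "\<rho> y"]
    by (auto simp: afforded_character_def representation_iff)
qed

lemma Irr_one_neq_zero:
  assumes "\<chi> \<in> Irr G"
  shows "\<chi> \<one> \<noteq> 0"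
  using assms
  by (auto simp: Irr_def irreducible_representation_def representation_iff afforded_character_def mat_trace_one)

lemma Irr_character: "\<chi> \<in> Irr G \<Longrightarrow> character G \<chi>"
  by (auto simp: Irr_def character_def irreducible_representation_def)

text \<open>In a basis adapted to an invariant subspace the representation is block triangular and its diagonal
blocks are representations. The trace sees only the diagonal blocks.\<close>

lemma reducible_representation_splits:
  assumes rep: "representation G n \<rho>" and red: "\<not> irreducible_representation G n \<rho>"
  obtains k \<alpha> l \<beta> where "k < n" "l < n" "representation G k \<alpha>" "representation G l \<beta>"
    "\<And>g. g \<in> carrier G \<Longrightarrow> mat_trace (\<rho> g) = mat_trace (\<alpha> g) + mat_trace (\<beta> g)"
proof -
  have rho: "\<And>g. g \<in> carrier G \<Longrightarrow> \<rho> g \<in> carrier_mat n n"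
    and rm: "\<And>g h. g \<in> carrier G \<Longrightarrow> h \<in> carrier G \<Longrightarrow> \<rho> (g \<otimes> h) = \<rho> g * \<rho> h"
    and r1: "\<rho> \<one> = 1\<^sub>m n"
    using rep by (auto simp: representation_iff)
  obtain W where sub: "VectorSpace.subspace class_ring W (module_vec TYPE(complex) n)"
    and inv: "\<And>g w. g \<in> carrier G \<Longrightarrow> w \<in> W \<Longrightarrow> \<rho> g *\<^sub>v w \<in> W"
    and W: "W \<noteq> {0\<^sub>v n}" "W \<noteq> carrier_vec n"
    using rep red unfolding irreducible_representation_def by blast
  obtain k P R where k: "0 < k" "k < n" and P: "P \<in> carrier_mat n n" and R: "R \<in> carrier_mat n n"
    and PR: "P * R = 1\<^sub>m n" and RP: "R * P = 1\<^sub>m n" and colW: "\<And>j. j < k \<Longrightarrow> col P j \<in> W"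
    and zW: "\<And>w i. w \<in> W \<Longrightarrow> k \<le> i \<Longrightarrow> i < n \<Longrightarrow> (R *\<^sub>v w) $ i = 0"
    using subspace_adapted_basis[OF sub W] by metis
  \<comment> \<open>the representation in the adapted basis\<close>
  define \<mu> where "\<mu> g = R * (\<rho> g * P)" for g
  have mu: "\<mu> g \<in> carrier_mat n n" if "g \<in> carrier G" for g
    using rho[OF that] P R by (auto simp: \<mu>_def)
  have mu1: "\<mu> \<one> = 1\<^sub>m n" using P RP by (simp add: \<mu>_def r1)
  have mum: "\<mu> (g \<otimes> h) = \<mu> g * \<mu> h" if gh: "g \<in> carrier G" "h \<in> carrier G" for g h
  proof -
    note c = rho[OF gh(1)] rho[OF gh(2)]
    have hP: "\<rho> h * P \<in> carrier_mat n n" and gP: "\<rho> g * P \<in> carrier_mat n n" using c P by auto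
    have "\<mu> g * \<mu> h = R * ((\<rho> g * P) * (R * (\<rho> h * P)))"
      using assoc_mult_mat[OF R gP mu[OF gh(2)]] by (simp add: \<mu>_def)
    also have "(\<rho> g * P) * (R * (\<rho> h * P)) = \<rho> g * (P * (R * (\<rho> h * P)))"
      using assoc_mult_mat[OF c(1) P mu[OF gh(2)]] by (simp add: \<mu>_def)
    also have "P * (R * (\<rho> h * P)) = \<rho> h * P"
      using assoc_mult_mat[OF P R hP] PR left_mult_one_mat[OF hP] by metis
    also have "\<rho> g * (\<rho> h * P) = \<rho> (g \<otimes> h) * P"
      using assoc_mult_mat[OF c P] rm[OF gh] by simp
    finally show ?thesis by (simp add: \<mu>_def)
  qed
  have mu0: "\<mu> g $$ (i, j) = 0" if g: "g \<in> carrier G" and ij: "k \<le> i" "i < n" "j < k" for g i j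
  proof -
    have j: "j < n" using ij by simp
    have "\<mu> g $$ (i, j) = (R *\<^sub>v col (\<rho> g * P) j) $ i"
      using rho[OF g] P R ij j by (simp add: \<mu>_def)
    also have "col (\<rho> g * P) j = \<rho> g *\<^sub>v col P j"
      using rho[OF g] P j by (intro col_mult2) auto
    finally show ?thesis using zW[OF inv[OF g colW[OF ij(3)]] ij(1,2)] by simp
  qed
  define \<alpha> where "\<alpha> g = mat k k (\<lambda>(i, j). \<mu> g $$ (i, j))" for g
  define \<beta> where "\<beta> g = mat (n - k) (n - k) (\<lambda>(i, j). \<mu> g $$ (k + i, k + j))" for g
  have split: "(\<Sum>l<n. f l) = (\<Sum>l<k. f l) + (\<Sum>l<n - k. f (k + l))" for f :: "nat \<Rightarrow> complex"
  proof -
    have "(\<Sum>l<n. f l) = (\<Sum>l\<in>{..<k}. f l) + (\<Sum>l\<in>{k..<n}. f l)"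
      using k(2) by (subst sum.union_disjoint[symmetric]) (auto intro!: sum.cong)
    also have "(\<Sum>l\<in>{k..<n}. f l) = (\<Sum>l<n - k. f (k + l))"
      by (rule sum.reindex_bij_witness[of _ "\<lambda>l. k + l" "\<lambda>l. l - k"]) (use k in auto)
    finally show ?thesis .
  qed
  have entry: "\<mu> (g \<otimes> h) $$ (i, j) = (\<Sum>l<k. \<mu> g $$ (i, l) * \<mu> h $$ (l, j))
      + (\<Sum>l<n - k. \<mu> g $$ (i, k + l) * \<mu> h $$ (k + l, j))"
    if "g \<in> carrier G" "h \<in> carrier G" "i < n" "j < n" for g h i j
    using that index_mult_mat_sum[OF mu mu, of g h i j] by (simp add: mum split)
  have ra: "representation G k \<alpha>"
    unfolding representation_iff
  proof (intro conjI ballI k(1))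
    fix g h assume gh: "g \<in> carrier G" "h \<in> carrier G"
    show "\<alpha> (g \<otimes> h) = \<alpha> g * \<alpha> h"
    proof (rule eq_matI)
      fix i j assume "i < dim_row (\<alpha> g * \<alpha> h)" "j < dim_col (\<alpha> g * \<alpha> h)"
      then have ij: "i < k" "j < k" by (auto simp: \<alpha>_def)
      have "(\<alpha> g * \<alpha> h) $$ (i, j) = (\<Sum>l<k. \<mu> g $$ (i, l) * \<mu> h $$ (l, j))"
        using ij by (subst index_mult_mat_sum[of _ k k _ k]) (auto simp: \<alpha>_def)
      then show "\<alpha> (g \<otimes> h) $$ (i, j) = (\<alpha> g * \<alpha> h) $$ (i, j)"
        using entry[OF gh, of i j] ij k gh by (simp add: \<alpha>_def mu0)
    qed (auto simp: \<alpha>_def)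
  qed (use k in \<open>auto simp: \<alpha>_def mu1 intro!: eq_matI\<close>)
  have rb: "representation G (n - k) \<beta>"
    unfolding representation_iff
  proof (intro conjI ballI)
    fix g h assume gh: "g \<in> carrier G" "h \<in> carrier G"
    show "\<beta> (g \<otimes> h) = \<beta> g * \<beta> h"
    proof (rule eq_matI)
      fix i j assume "i < dim_row (\<beta> g * \<beta> h)" "j < dim_col (\<beta> g * \<beta> h)"
      then have ij: "i < n - k" "j < n - k" by (auto simp: \<beta>_def)
      have "(\<beta> g * \<beta> h) $$ (i, j) = (\<Sum>l<n - k. \<mu> g $$ (k + i, k + l) * \<mu> h $$ (k + l, k + j))"
        using ij by (subst index_mult_mat_sum[of _ "n - k" "n - k" _ "n - k"]) (auto simp: \<beta>_def)
      then show "\<beta> (g \<otimes> h) $$ (i, j) = (\<beta> g * \<beta> h) $$ (i, j)"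
        using entry[OF gh, of "k + i" "k + j"] ij k gh by (simp add: \<beta>_def mu0)
    qed (auto simp: \<beta>_def)
  qed (use k in \<open>auto simp: \<beta>_def mu1 intro!: eq_matI\<close>)
  have "mat_trace (\<rho> g) = mat_trace (\<alpha> g) + mat_trace (\<beta> g)" if g: "g \<in> carrier G" for g
  proof -
    have gP: "\<rho> g * P \<in> carrier_mat n n" using rho[OF g] P by auto
    have "mat_trace (\<mu> g) = mat_trace ((\<rho> g * P) * R)"
      unfolding \<mu>_def by (rule mat_trace_mult_comm[OF R gP])
    also have "(\<rho> g * P) * R = \<rho> g"
      using assoc_mult_mat[OF rho[OF g] P R] PR rho[OF g] by simp
    finally have "mat_trace (\<rho> g) = (\<Sum>i<n. \<mu> g $$ (i, i))"
      using carrier_matD(1)[OF mu[OF g]] by (simp add: mat_trace_def)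
    then show ?thesis unfolding split by (simp add: mat_trace_def \<alpha>_def \<beta>_def)
  qed
  then show ?thesis using that[OF k(2) _ ra rb] k by simp
qed

lemma representation_trace_sum_Irr:
  assumes "representation G n \<rho>"
  shows "\<exists>M. M \<noteq> {#} \<and> set_mset M \<subseteq> Irr G \<and> (\<forall>g\<in>carrier G. mat_trace (\<rho> g) = (\<Sum>\<chi>\<in>#M. \<chi> g))"
  using assms
proof (induction n arbitrary: \<rho> rule: less_induct)
  case (less n)
  show ?case
  proof (cases "irreducible_representation G n \<rho>")
    case True
    then have "afforded_character G \<rho> \<in> Irr G" by (auto simp: Irr_def)
    then show ?thesis by (intro exI[of _ "{#afforded_character G \<rho>#}"]) (auto simp: afforded_character_def)
  next
    case False
    obtain k \<alpha> l \<beta> where *: "k < n" "l < n" "representation G k \<alpha>" "representation G l \<beta>"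
      "\<And>g. g \<in> carrier G \<Longrightarrow> mat_trace (\<rho> g) = mat_trace (\<alpha> g) + mat_trace (\<beta> g)"
      using reducible_representation_splits[OF less.prems False] by metis
    obtain A where A: "A \<noteq> {#}" "set_mset A \<subseteq> Irr G"
      "\<forall>g\<in>carrier G. mat_trace (\<alpha> g) = (\<Sum>\<chi>\<in>#A. \<chi> g)" using less.IH[OF *(1,3)] by blast
    obtain B where B: "set_mset B \<subseteq> Irr G"
      "\<forall>g\<in>carrier G. mat_trace (\<beta> g) = (\<Sum>\<chi>\<in>#B. \<chi> g)" using less.IH[OF *(2,4)] by blast
    show ?thesis using A B *(5) by (intro exI[of _ "A + B"]) auto
  qed
qed

text \<open>The direct sum of two representations affords the sum of their characters.\<close>

lemma character_add:
  assumes "character G \<xi>" "character G \<eta>"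
  shows "character G (restrict (\<lambda>g. \<xi> g + \<eta> g) (carrier G))"
proof -
  obtain n \<rho> m \<sigma> where r: "representation G n \<rho>" "\<xi> = afforded_character G \<rho>"
    and s: "representation G m \<sigma>" "\<eta> = afforded_character G \<sigma>"
    using assms by (auto simp: character_def)
  have n: "0 < n" and rho: "\<And>g. g \<in> carrier G \<Longrightarrow> \<rho> g \<in> carrier_mat n n"
    and rm: "\<And>g h. g \<in> carrier G \<Longrightarrow> h \<in> carrier G \<Longrightarrow> \<rho> (g \<otimes> h) = \<rho> g * \<rho> h"
    and r1: "\<rho> \<one> = 1\<^sub>m n"
    using r by (auto simp: representation_iff)
  have sig: "\<And>g. g \<in> carrier G \<Longrightarrow> \<sigma> g \<in> carrier_mat m m"
    and sm: "\<And>g h. g \<in> carrier G \<Longrightarrow> h \<in> carrier G \<Longrightarrow> \<sigma> (g \<otimes> h) = \<sigma> g * \<sigma> h"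
    and s1: "\<sigma> \<one> = 1\<^sub>m m"
    using s by (auto simp: representation_iff)
  define \<tau> where "\<tau> g = four_block_mat (\<rho> g) (0\<^sub>m n m) (0\<^sub>m m n) (\<sigma> g)" for g
  have "representation G (n + m) \<tau>"
    unfolding representation_iff
  proof (intro conjI ballI)
    fix g h assume gh: "g \<in> carrier G" "h \<in> carrier G"
    show "\<tau> (g \<otimes> h) = \<tau> g * \<tau> h"
      unfolding \<tau>_def using rho[OF gh(1)] rho[OF gh(2)] sig[OF gh(1)] sig[OF gh(2)]
      by (subst mult_four_block_mat) (auto simp: rm[OF gh] sm[OF gh])
  qed (use n rho sig in \<open>auto simp: \<tau>_def r1 s1\<close>)
  moreover have "restrict (\<lambda>g. \<xi> g + \<eta> g) (carrier G) = afforded_character G \<tau>"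
    unfolding afforded_character_def
  proof (rule restrict_ext)
    fix g assume g: "g \<in> carrier G"
    have d: "dim_row (\<rho> g) = n" "dim_row (\<sigma> g) = m" "dim_col (\<rho> g) = n" "dim_col (\<sigma> g) = m"
      using rho[OF g] sig[OF g] by auto
    have "mat_trace (\<tau> g) = (\<Sum>i<n. \<tau> g $$ (i, i)) + (\<Sum>i\<in>{n..<n + m}. \<tau> g $$ (i, i))"
      unfolding mat_trace_def
      by (subst sum.union_disjoint[symmetric]) (auto simp: \<tau>_def d intro!: sum.cong)
    also have "(\<Sum>i<n. \<tau> g $$ (i, i)) = mat_trace (\<rho> g)"
      by (simp add: mat_trace_def \<tau>_def d)
    also have "(\<Sum>i\<in>{n..<n + m}. \<tau> g $$ (i, i)) = mat_trace (\<sigma> g)"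
      unfolding mat_trace_def
      by (rule sum.reindex_bij_witness[of _ "\<lambda>i. n + i" "\<lambda>i. i - n"]) (auto simp: \<tau>_def d)
    finally show "\<xi> g + \<eta> g = mat_trace (\<tau> g)" using g by (simp add: r(2) s(2) afforded_character_def)
  qed
  ultimately show ?thesis by (auto simp: character_def)
qed

lemma character_sum_mset:
  assumes "M \<noteq> {#}" "\<And>\<chi>. \<chi> \<in># M \<Longrightarrow> character G \<chi>"
  shows "character G (restrict (\<lambda>g. \<Sum>\<chi>\<in>#M. \<chi> g) (carrier G))"
  using assms
proof (induction M)
  case (add \<chi> M)
  show ?case
  proof (cases "M = {#}")
    case True
    have "restrict \<chi> (carrier G) = \<chi>"
      using add.prems(2)[of \<chi>] by (auto simp: character_def afforded_character_def)
    then show ?thesis using True add.prems(2)[of \<chi>] by simp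
  next
    case False
    have "character G (restrict (\<lambda>g. \<chi> g + restrict (\<lambda>g. \<Sum>\<chi>\<in>#M. \<chi> g) (carrier G) g) (carrier G))"
      using False add by (intro character_add) auto
    also have "restrict (\<lambda>g. \<chi> g + restrict (\<lambda>g. \<Sum>\<chi>\<in>#M. \<chi> g) (carrier G) g) (carrier G)
        = restrict (\<lambda>g. \<Sum>\<chi>\<in>#add_mset \<chi> M. \<chi> g) (carrier G)"
      by (intro restrict_ext) simp
    finally show ?thesis .
  qed
qed simp

text \<open>The multiset records multiplicities. That its members are constituents in the sense of
\<open>Irr_constituents\<close> uses closure of characters under addition: removing one summand leaves nothing or
another character.\<close>

lemma character_expansion:
  assumes "character G \<xi>"
  shows "\<exists>M. M \<noteq> {#} \<and> set_mset M \<subseteq> Irr_constituents G \<xi> \<and> (\<forall>g\<in>carrier G. \<xi> g = (\<Sum>\<chi>\<in>#M. \<chi> g))"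
proof -
  obtain n \<rho> where r: "representation G n \<rho>" "\<xi> = afforded_character G \<rho>"
    using assms by (auto simp: character_def)
  obtain M where M: "M \<noteq> {#}" "set_mset M \<subseteq> Irr G"
    "\<And>g. g \<in> carrier G \<Longrightarrow> \<xi> g = (\<Sum>\<chi>\<in>#M. \<chi> g)"
    using representation_trace_sum_Irr[OF r(1)] r(2) by (auto simp: afforded_character_def)
  have "\<chi> \<in> Irr_constituents G \<xi>" if chi: "\<chi> \<in># M" for \<chi>
  proof -
    obtain N where N: "M = add_mset \<chi> N" using multi_member_split[OF chi] by blast
    show ?thesis
    proof (cases "N = {#}")
      case True
      have ext: "character G \<chi>" using M(2) chi Irr_character by blast
      have "\<xi> = \<chi>"
      proof
        fix g show "\<xi> g = \<chi> g"
          using M(3)[of g] ext r(2) True N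
          by (cases "g \<in> carrier G") (auto simp: character_def afforded_character_def)
      qed
      then show ?thesis using M(2) chi by (auto simp: Irr_constituents_def)
    next
      case False
      have "character G (restrict (\<lambda>g. \<Sum>\<chi>\<in>#N. \<chi> g) (carrier G))"
        using False M(2) N Irr_character by (intro character_sum_mset) auto
      moreover have "\<forall>g\<in>carrier G. \<xi> g = \<chi> g + restrict (\<lambda>g. \<Sum>\<chi>\<in>#N. \<chi> g) (carrier G) g"
        using M(3) N by simp
      ultimately show ?thesis using M(2) chi unfolding Irr_constituents_def by blast
    qed
  qed
  then show ?thesis using M by blast
qed

end

section \<open>Orthogonality of irreducible characters\<close>

locale finite_order_group = group G for G (structure) +
  assumes finite_carrier: "finite (carrier G)"
begin

lemma sum_translate_left:
  assumes "h \<in> carrier G"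
  shows "(\<Sum>g\<in>carrier G. f (h \<otimes> g)) = (\<Sum>g\<in>carrier G. f g)"
  by (rule sum.reindex_bij_witness[of _ "\<lambda>g. inv h \<otimes> g" "\<lambda>g. h \<otimes> g"])
    (use assms in \<open>auto simp: m_assoc[symmetric]\<close>)

text \<open>For a character \<open>h\<close> of a finite group \<open>h (inv g)\<close> is the complex conjugate of \<open>h g\<close>, so this bilinear
form restricts to \<open>|G|\<close> times the usual inner product of characters.\<close>

definition char_form :: "('a \<Rightarrow> complex) \<Rightarrow> ('a \<Rightarrow> complex) \<Rightarrow> complex" where
  "char_form f h = (\<Sum>g\<in>carrier G. f g * h (inv g))"

text \<open>The average over \<open>g\<close> of \<open>\<rho> g * E * \<sigma> (inv g)\<close>, up to the factor \<open>|G|\<close>, where \<open>E\<close> is the matrix unit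
with its 1 in position \<open>(j, k)\<close>.\<close>

definition averaged_mat ::
    "nat \<Rightarrow> nat \<Rightarrow> ('a \<Rightarrow> complex mat) \<Rightarrow> ('a \<Rightarrow> complex mat) \<Rightarrow> nat \<Rightarrow> nat \<Rightarrow> complex mat" where
  "averaged_mat n m \<rho> \<sigma> j k =
     mat n m (\<lambda>(i, l). \<Sum>g\<in>carrier G. \<rho> g $$ (i, j) * \<sigma> (inv g) $$ (k, l))"

lemma averaged_mat_intertwines:
  assumes r: "representation G n \<rho>" and s: "representation G m \<sigma>"
    and jk: "j < n" "k < m" and h: "h \<in> carrier G"
  shows "\<rho> h * averaged_mat n m \<rho> \<sigma> j k = averaged_mat n m \<rho> \<sigma> j k * \<sigma> h"
proof -
  have rho: "\<And>g. g \<in> carrier G \<Longrightarrow> \<rho> g \<in> carrier_mat n n"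
    and rm: "\<And>g h. g \<in> carrier G \<Longrightarrow> h \<in> carrier G \<Longrightarrow> \<rho> (g \<otimes> h) = \<rho> g * \<rho> h"
    using r by (auto simp: representation_iff)
  have sig: "\<And>g. g \<in> carrier G \<Longrightarrow> \<sigma> g \<in> carrier_mat m m"
    and sm: "\<And>g h. g \<in> carrier G \<Longrightarrow> h \<in> carrier G \<Longrightarrow> \<sigma> (g \<otimes> h) = \<sigma> g * \<sigma> h"
    using s by (auto simp: representation_iff)
  let ?T = "averaged_mat n m \<rho> \<sigma> j k"
  have T: "?T \<in> carrier_mat n m" by (simp add: averaged_mat_def)
  show ?thesis
  proof (rule eq_matI)
    fix i l assume "i < dim_row (?T * \<sigma> h)" "l < dim_col (?T * \<sigma> h)"
    then have il: "i < n" "l < m" using T sig[OF h] by auto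
    have "(\<rho> h * ?T) $$ (i, l)
        = (\<Sum>p<n. \<rho> h $$ (i, p) * (\<Sum>g\<in>carrier G. \<rho> g $$ (p, j) * \<sigma> (inv g) $$ (k, l)))"
      using il by (subst index_mult_mat_sum[OF rho[OF h] T]) (auto simp: averaged_mat_def)
    also have "\<dots> = (\<Sum>g\<in>carrier G. (\<Sum>p<n. \<rho> h $$ (i, p) * \<rho> g $$ (p, j)) * \<sigma> (inv g) $$ (k, l))"
      by (subst sum_distrib_left, subst sum.swap) (simp add: sum_distrib_right mult.assoc)
    also have "\<dots> = (\<Sum>g\<in>carrier G. \<rho> (h \<otimes> g) $$ (i, j) * \<sigma> (inv (h \<otimes> g) \<otimes> h) $$ (k, l))"
    proof (rule sum.cong[OF refl])
      fix g assume g: "g \<in> carrier G"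
      have "inv (h \<otimes> g) \<otimes> h = inv g"
        using g h by (simp add: inv_mult_group m_assoc)
      then show "(\<Sum>p<n. \<rho> h $$ (i, p) * \<rho> g $$ (p, j)) * \<sigma> (inv g) $$ (k, l)
          = \<rho> (h \<otimes> g) $$ (i, j) * \<sigma> (inv (h \<otimes> g) \<otimes> h) $$ (k, l)"
        using index_mult_mat_sum[OF rho[OF h] rho[OF g] il(1) jk(1)] rm[OF h g] by simp
    qed
    \<comment> \<open>substitute \<open>g\<close> for \<open>h \<otimes> g\<close>\<close>
    also have "\<dots> = (\<Sum>g\<in>carrier G. \<rho> g $$ (i, j) * \<sigma> (inv g \<otimes> h) $$ (k, l))"
      by (rule sum_translate_left[OF h])
    also have "\<dots> = (\<Sum>g\<in>carrier G. \<rho> g $$ (i, j) * (\<Sum>p<m. \<sigma> (inv g) $$ (k, p) * \<sigma> h $$ (p, l)))"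
      using sm h index_mult_mat_sum[OF sig sig jk(2) il(2)] by (intro sum.cong) auto
    also have "\<dots> = (\<Sum>p<m. (\<Sum>g\<in>carrier G. \<rho> g $$ (i, j) * \<sigma> (inv g) $$ (k, p)) * \<sigma> h $$ (p, l))"
      by (subst sum_distrib_left, subst sum.swap) (simp add: sum_distrib_right mult.assoc)
    also have "\<dots> = (?T * \<sigma> h) $$ (i, l)"
      using il by (subst index_mult_mat_sum[OF T sig[OF h]]) (auto simp: averaged_mat_def)
    finally show "(\<rho> h * ?T) $$ (i, l) = (?T * \<sigma> h) $$ (i, l)" .
  qed (use T rho[OF h] sig[OF h] in auto)
qed

lemma char_form_averaged_mat:
  assumes r: "representation G n \<rho>" and s: "representation G m \<sigma>"
  shows "char_form (afforded_character G \<rho>) (afforded_character G \<sigma>)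
    = (\<Sum>j<n. \<Sum>k<m. averaged_mat n m \<rho> \<sigma> j k $$ (j, k))"
proof -
  have rho: "\<And>g. g \<in> carrier G \<Longrightarrow> \<rho> g \<in> carrier_mat n n" using r by (auto simp: representation_iff)
  have sig: "\<And>g. g \<in> carrier G \<Longrightarrow> \<sigma> g \<in> carrier_mat m m" using s by (auto simp: representation_iff)
  have "char_form (afforded_character G \<rho>) (afforded_character G \<sigma>)
      = (\<Sum>g\<in>carrier G. (\<Sum>j<n. \<rho> g $$ (j, j)) * (\<Sum>k<m. \<sigma> (inv g) $$ (k, k)))"
    unfolding char_form_def
  proof (rule sum.cong[OF refl])
    fix g assume g: "g \<in> carrier G"
    then show "afforded_character G \<rho> g * afforded_character G \<sigma> (inv g)
      = (\<Sum>j<n. \<rho> g $$ (j, j)) * (\<Sum>k<m. \<sigma> (inv g) $$ (k, k))"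
      using carrier_matD(1)[OF rho[OF g]] carrier_matD(1)[OF sig[OF inv_closed[OF g]]]
      by (simp add: afforded_character_def mat_trace_def)
  qed
  also have "\<dots> = (\<Sum>j<n. \<Sum>k<m. \<Sum>g\<in>carrier G. \<rho> g $$ (j, j) * \<sigma> (inv g) $$ (k, k))"
    by (simp add: sum_product) (subst sum.swap, rule sum.cong[OF refl], rule sum.swap)
  finally show ?thesis by (simp add: averaged_mat_def)
qed

text \<open>The averaged matrices are intertwiners between inequivalent irreducible representations and vanish.\<close>

lemma Irr_orthogonal:
  assumes "\<chi> \<in> Irr G" "\<psi> \<in> Irr G" "\<chi> \<noteq> \<psi>"
  shows "char_form \<chi> \<psi> = 0"
proof -
  obtain n \<rho> m \<sigma> where r: "irreducible_representation G n \<rho>" "\<chi> = afforded_character G \<rho>"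
    and s: "irreducible_representation G m \<sigma>" "\<psi> = afforded_character G \<sigma>"
    using assms by (auto simp: Irr_def)
  have rep: "representation G n \<rho>" "representation G m \<sigma>"
    using r s by (auto simp: irreducible_representation_def)
  have "averaged_mat n m \<rho> \<sigma> j k = 0\<^sub>m n m" if jk: "j < n" "k < m" for j k
  proof (rule ccontr)
    assume nz: "averaged_mat n m \<rho> \<sigma> j k \<noteq> 0\<^sub>m n m"
    have "mat_trace (\<rho> g) = mat_trace (\<sigma> g)" if "g \<in> carrier G" for g
      using intertwiner_imp_same_trace[OF r(1) s(1) _ averaged_mat_intertwines[OF rep jk] nz that]
      by (simp add: averaged_mat_def)
    then have "\<chi> = \<psi>" unfolding r(2) s(2) afforded_character_def by (intro restrict_ext)
    then show False using assms(3) by simp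
  qed
  then show ?thesis unfolding r(2) s(2) char_form_averaged_mat[OF rep] by simp
qed

text \<open>Here the averaged matrices are scalar, and the scalar is read off from the trace.\<close>

lemma Irr_norm:
  assumes "\<chi> \<in> Irr G"
  shows "char_form \<chi> \<chi> = of_nat (card (carrier G))"
proof -
  obtain n \<rho> where r: "irreducible_representation G n \<rho>" "\<chi> = afforded_character G \<rho>"
    using assms by (auto simp: Irr_def)
  have rep: "representation G n \<rho>" using r by (auto simp: irreducible_representation_def)
  have n: "0 < n" and rho: "\<And>g. g \<in> carrier G \<Longrightarrow> \<rho> g \<in> carrier_mat n n"
    and rm: "\<And>g h. g \<in> carrier G \<Longrightarrow> h \<in> carrier G \<Longrightarrow> \<rho> (g \<otimes> h) = \<rho> g * \<rho> h"
    and r1: "\<rho> \<one> = 1\<^sub>m n"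
    using rep by (auto simp: representation_iff)
  let ?c = "of_nat (card (carrier G)) :: complex"
  have entry: "averaged_mat n n \<rho> \<rho> j k $$ (j, k) = (if j = k then ?c / of_nat n else 0)"
    if jk: "j < n" "k < n" for j k
  proof -
    let ?T = "averaged_mat n n \<rho> \<rho> j k"
    have T: "?T \<in> carrier_mat n n" by (simp add: averaged_mat_def)
    obtain c where c: "?T = c \<cdot>\<^sub>m 1\<^sub>m n"
      using commuting_imp_scalar[OF r(1) T averaged_mat_intertwines[OF rep rep jk]] by blast
    have "of_nat n * c = mat_trace ?T"
      by (simp add: c mat_trace_def)
    also have "\<dots> = (\<Sum>i<n. \<Sum>g\<in>carrier G. \<rho> g $$ (i, j) * \<rho> (inv g) $$ (k, i))"
      by (simp add: mat_trace_def averaged_mat_def)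
    also have "\<dots> = (\<Sum>g\<in>carrier G. \<Sum>i<n. \<rho> (inv g) $$ (k, i) * \<rho> g $$ (i, j))"
      by (subst sum.swap) (simp add: mult.commute)
    also have "\<dots> = (\<Sum>g\<in>carrier G. 1\<^sub>m n $$ (k, j))"
    proof (rule sum.cong[OF refl])
      fix g assume g: "g \<in> carrier G"
      have "\<rho> (inv g) * \<rho> g = 1\<^sub>m n" using rm[OF inv_closed[OF g] g] g r1 by simp
      then show "(\<Sum>i<n. \<rho> (inv g) $$ (k, i) * \<rho> g $$ (i, j)) = 1\<^sub>m n $$ (k, j)"
        using index_mult_mat_sum[OF rho[OF inv_closed[OF g]] rho[OF g] jk(2,1)] by simp
    qed
    also have "\<dots> = (if j = k then ?c else 0)" using jk by simp
    finally have "of_nat n * c = (if j = k then ?c else 0)" .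
    then have "c = (if j = k then ?c / of_nat n else 0)" using n by (auto simp: field_simps)
    then show ?thesis using jk by (simp add: c)
  qed
  have "char_form \<chi> \<chi> = (\<Sum>j<n. \<Sum>k<n. (if j = k then ?c / of_nat n else 0))"
    unfolding r(2) char_form_averaged_mat[OF rep rep] by (intro sum.cong refl) (simp add: entry)
  also have "\<dots> = ?c" using n by simp
  finally show ?thesis .
qed

lemma char_form_eq_multiplicity:
  assumes xi: "\<And>g. g \<in> carrier G \<Longrightarrow> \<xi> g = (\<Sum>\<chi>\<in>#M. \<chi> g)" and M: "set_mset M \<subseteq> Irr G" and psi: "\<psi> \<in> Irr G"
  shows "char_form \<xi> \<psi> = of_nat (card (carrier G)) * of_nat (count M \<psi>)"
proof -
  have "char_form \<xi> \<psi> = char_form (\<lambda>g. \<Sum>\<chi>\<in>#M. \<chi> g) \<psi>" by (simp add: char_form_def xi)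
  also have "\<dots> = of_nat (card (carrier G)) * of_nat (count M \<psi>)"
    using M
  proof (induction M)
    case empty
    then show ?case by (simp add: char_form_def)
  next
    case (add \<chi> M)
    have "char_form (\<lambda>g. \<Sum>\<chi>\<in>#add_mset \<chi> M. \<chi> g) \<psi> = char_form \<chi> \<psi> + char_form (\<lambda>g. \<Sum>\<chi>\<in>#M. \<chi> g) \<psi>"
      by (simp add: char_form_def distrib_right sum.distrib)
    also have "char_form \<chi> \<psi> = (if \<chi> = \<psi> then of_nat (card (carrier G)) else 0)"
      using add.prems psi Irr_norm Irr_orthogonal by auto
    finally show ?case using add by (simp add: distrib_left)
  qed
  finally show ?thesis .
qed

text \<open>An irreducible character that occurs in only one member of a family of characters picks out the
coefficient of that member. Linear independence of the \<open>\<xi> X\<close> and the eigenvalues of coset sums are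
both obtained this way.\<close>

lemma pairing_extracts_coefficient:
  fixes \<xi> :: "'i \<Rightarrow> 'a \<Rightarrow> complex"
  assumes I: "finite I" and X: "X \<in> I" and chi: "\<chi> \<in># M X"
    and irr: "\<And>Y. Y \<in> I \<Longrightarrow> set_mset (M Y) \<subseteq> Irr G"
    and ex: "\<And>Y g. Y \<in> I \<Longrightarrow> g \<in> carrier G \<Longrightarrow> \<xi> Y g = (\<Sum>\<chi>\<in>#M Y. \<chi> g)"
    and disj: "\<And>Y. Y \<in> I \<Longrightarrow> \<chi> \<in># M Y \<Longrightarrow> Y = X"
    and f: "\<And>g. g \<in> carrier G \<Longrightarrow> f g = (\<Sum>Y\<in>I. v Y * \<xi> Y g)"
  shows "char_form f \<chi> = v X * (of_nat (card (carrier G)) * of_nat (count (M X) \<chi>))"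
proof -
  have chi_irr: "\<chi> \<in> Irr G" using irr[OF X] chi by blast
  have "char_form f \<chi> = (\<Sum>g\<in>carrier G. (\<Sum>Y\<in>I. v Y * \<xi> Y g) * \<chi> (inv g))"
    unfolding char_form_def by (intro sum.cong refl) (simp only: f)
  also have "\<dots> = (\<Sum>Y\<in>I. v Y * char_form (\<xi> Y) \<chi>)"
    by (simp add: char_form_def sum_distrib_left sum_distrib_right mult.assoc) (rule sum.swap)
  also have "\<dots> = (\<Sum>Y\<in>I. v Y * (of_nat (card (carrier G)) * of_nat (count (M Y) \<chi>)))"
  proof (rule sum.cong[OF refl])
    fix Y assume Y: "Y \<in> I"
    show "v Y * char_form (\<xi> Y) \<chi> = v Y * (of_nat (card (carrier G)) * of_nat (count (M Y) \<chi>))"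
      using char_form_eq_multiplicity[OF ex[OF Y] irr[OF Y] chi_irr] by simp
  qed
  also have "\<dots> = (\<Sum>Y\<in>{X}. v Y * (of_nat (card (carrier G)) * of_nat (count (M Y) \<chi>)))"
    using I X disj by (intro sum.mono_neutral_right) (auto simp: count_eq_zero_iff)
  finally show ?thesis by simp
qed

section \<open>Sums of characters over cosets of a normal subgroup\<close>

definition coset_sum :: "'a set \<Rightarrow> ('a \<Rightarrow> complex) \<Rightarrow> 'a \<Rightarrow> complex" where
  "coset_sum M f x = (\<Sum>m\<in>M. f (x \<otimes> m))"

text \<open>The sum \<open>E\<close> of the matrices of elements of \<open>M\<close> commutes with the representation because \<open>M\<close> is normal,
so it is a scalar \<open>c\<close> by Schur's lemma, and \<open>E\<close> squared is \<open>|M|\<close> times \<open>E\<close>, so \<open>c\<close> is 0 or \<open>|M|\<close>. The coset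
sum at \<open>x\<close> is the trace of \<open>\<rho> x * E\<close>.\<close>

lemma coset_sum_Irr:
  assumes chi: "\<chi> \<in> Irr G" and M: "M \<lhd> G"
  shows "(\<forall>x\<in>carrier G. coset_sum M \<chi> x = of_nat (card M) * \<chi> x) \<or> (\<forall>x\<in>carrier G. coset_sum M \<chi> x = 0)"
proof -
  interpret M: normal M G by (rule M)
  obtain n \<rho> where r: "irreducible_representation G n \<rho>" "\<chi> = afforded_character G \<rho>"
    using chi by (auto simp: Irr_def)
  have rep: "representation G n \<rho>" using r by (auto simp: irreducible_representation_def)
  have n: "0 < n" and rho: "\<And>g. g \<in> carrier G \<Longrightarrow> \<rho> g \<in> carrier_mat n n"
    and rm: "\<And>g h. g \<in> carrier G \<Longrightarrow> h \<in> carrier G \<Longrightarrow> \<rho> (g \<otimes> h) = \<rho> g * \<rho> h"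
    and r1: "\<rho> \<one> = 1\<^sub>m n"
    using rep by (auto simp: representation_iff)
  define E where "E = mat n n (\<lambda>(i, j). \<Sum>m\<in>M. \<rho> m $$ (i, j))"
  have E: "E \<in> carrier_mat n n" by (simp add: E_def)
  have left: "(\<rho> g * E) $$ (i, j) = (\<Sum>m\<in>M. \<rho> (g \<otimes> m) $$ (i, j))"
    if g: "g \<in> carrier G" and ij: "i < n" "j < n" for g i j
  proof -
    have "(\<rho> g * E) $$ (i, j) = (\<Sum>p<n. \<rho> g $$ (i, p) * (\<Sum>m\<in>M. \<rho> m $$ (p, j)))"
      using ij by (subst index_mult_mat_sum[OF rho[OF g] E]) (auto simp: E_def)
    also have "\<dots> = (\<Sum>m\<in>M. \<Sum>p<n. \<rho> g $$ (i, p) * \<rho> m $$ (p, j))"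
      by (subst sum_distrib_left, subst sum.swap) simp
    also have "\<dots> = (\<Sum>m\<in>M. \<rho> (g \<otimes> m) $$ (i, j))"
      using rm[OF g] index_mult_mat_sum[OF rho[OF g] rho ij] by (intro sum.cong) auto
    finally show ?thesis .
  qed
  have right: "(E * \<rho> g) $$ (i, j) = (\<Sum>m\<in>M. \<rho> (m \<otimes> g) $$ (i, j))"
    if g: "g \<in> carrier G" and ij: "i < n" "j < n" for g i j
  proof -
    have "(E * \<rho> g) $$ (i, j) = (\<Sum>p<n. (\<Sum>m\<in>M. \<rho> m $$ (i, p)) * \<rho> g $$ (p, j))"
      using ij by (subst index_mult_mat_sum[OF E rho[OF g]]) (auto simp: E_def)
    also have "\<dots> = (\<Sum>m\<in>M. \<Sum>p<n. \<rho> m $$ (i, p) * \<rho> g $$ (p, j))"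
      by (subst sum_distrib_right, subst sum.swap) simp
    also have "\<dots> = (\<Sum>m\<in>M. \<rho> (m \<otimes> g) $$ (i, j))"
      using rm[OF _ g] index_mult_mat_sum[OF rho rho[OF g] ij] by (intro sum.cong) auto
    finally show ?thesis .
  qed
  have "\<rho> g * E = E * \<rho> g" if g: "g \<in> carrier G" for g
  proof (rule eq_matI)
    fix i j assume "i < dim_row (E * \<rho> g)" "j < dim_col (E * \<rho> g)"
    then have ij: "i < n" "j < n" using E rho[OF g] by auto
    have "(\<Sum>m\<in>M. \<rho> (g \<otimes> m) $$ (i, j)) = (\<Sum>m\<in>M. \<rho> (m \<otimes> g) $$ (i, j))"
      by (rule sum.reindex_bij_witness[of _ "\<lambda>m. inv g \<otimes> m \<otimes> g" "\<lambda>m. g \<otimes> m \<otimes> inv g"])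
        (use g M.inv_op_closed1[OF g] M.inv_op_closed2[OF g] in
          \<open>auto simp: m_assoc inv_solve_left' m_assoc[symmetric, of g "inv g"]\<close>)
    then show "(\<rho> g * E) $$ (i, j) = (E * \<rho> g) $$ (i, j)" by (simp add: left[OF g ij] right[OF g ij])
  qed (use E rho[OF g] in auto)
  then obtain c where c: "E = c \<cdot>\<^sub>m 1\<^sub>m n" using commuting_imp_scalar[OF r(1) E] by blast
  \<comment> \<open>compute the entry \<open>(0, 0)\<close> of \<open>E * E\<close> in two ways; the position exists as the degree is positive\<close>
  have "(\<Sum>m\<in>M. \<rho> (m' \<otimes> m) $$ (0, 0)) = c" if m': "m' \<in> M" for m'
  proof -
    have "(\<Sum>m\<in>M. \<rho> (m' \<otimes> m) $$ (0, 0)) = (\<Sum>m\<in>M. \<rho> m $$ (0, 0))"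
      by (rule sum.reindex_bij_witness[of _ "\<lambda>m. inv m' \<otimes> m" "\<lambda>m. m' \<otimes> m"])
        (use m' in \<open>auto simp: m_assoc[symmetric]\<close>)
    also have "\<dots> = E $$ (0, 0)" using n by (simp add: E_def)
    finally show ?thesis using n by (simp add: c)
  qed
  then have "of_nat (card M) * c = (\<Sum>m'\<in>M. \<Sum>m\<in>M. \<rho> (m' \<otimes> m) $$ (0, 0))" by simp
  also have "\<dots> = (\<Sum>m'\<in>M. (\<rho> m' * E) $$ (0, 0))" using n by (intro sum.cong) (auto simp: left)
  also have "\<dots> = (\<Sum>m'\<in>M. c * \<rho> m' $$ (0, 0))"
  proof (rule sum.cong[OF refl])
    fix m' assume "m' \<in> M"
    then have "\<rho> m' \<in> carrier_mat n n" using rho by simp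
    then show "(\<rho> m' * E) $$ (0, 0) = c * \<rho> m' $$ (0, 0)"
      using n by (simp add: c mult_smult_distrib)
  qed
  also have "\<dots> = c * E $$ (0, 0)" using n by (simp add: E_def sum_distrib_left)
  also have "\<dots> = c * c" using n by (simp add: c)
  finally have c2: "c = 0 \<or> c = of_nat (card M)" by auto
  have "coset_sum M \<chi> x = c * \<chi> x" if x: "x \<in> carrier G" for x
  proof -
    have "coset_sum M \<chi> x = (\<Sum>m\<in>M. \<Sum>i<n. \<rho> (x \<otimes> m) $$ (i, i))"
      unfolding coset_sum_def
    proof (rule sum.cong[OF refl])
      fix m assume "m \<in> M"
      then have xm: "x \<otimes> m \<in> carrier G" using x by simp
      show "\<chi> (x \<otimes> m) = (\<Sum>i<n. \<rho> (x \<otimes> m) $$ (i, i))"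
        using carrier_matD(1)[OF rho[OF xm]] xm
        by (simp add: r(2) afforded_character_def mat_trace_def)
    qed
    also have "\<dots> = (\<Sum>i<n. (\<rho> x * E) $$ (i, i))"
      by (subst sum.swap) (simp add: left[OF x])
    also have "\<dots> = (\<Sum>i<n. c * \<rho> x $$ (i, i))"
      using rho[OF x] by (simp add: c mult_smult_distrib)
    also have "\<dots> = c * \<chi> x"
      using carrier_matD(1)[OF rho[OF x]] x
      by (simp add: r(2) afforded_character_def mat_trace_def sum_distrib_left)
    finally show ?thesis .
  qed
  then show ?thesis using c2 by auto
qed

end

section \<open>Functions constant on superclasses\<close>

lemma sum_sum_mset_swap:
  fixes f :: "'i \<Rightarrow> 'j \<Rightarrow> complex"
  shows "(\<Sum>i\<in>I. \<Sum>j\<in>#M. f i j) = (\<Sum>j\<in>#M. \<Sum>i\<in>I. f i j)"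
  by (induction M) (simp_all add: sum.distrib)

text \<open>A square system with independent rows is solvable, for arbitrary finite index sets of equal size.\<close>

lemma square_system_solvable:
  fixes a :: "'i \<Rightarrow> 'j \<Rightarrow> complex"
  assumes I: "finite I" and J: "finite J" and c: "card I = card J"
    and indep: "\<And>v. \<forall>j\<in>J. (\<Sum>i\<in>I. v i * a i j) = 0 \<Longrightarrow> \<forall>i\<in>I. v i = 0"
  shows "\<exists>v. \<forall>j\<in>J. (\<Sum>i\<in>I. v i * a i j) = b j"
proof -
  define n where "n = card I"
  obtain e where e: "bij_betw e {0..<n} I" using ex_bij_betw_nat_finite[OF I] by (auto simp: n_def)
  obtain f where f: "bij_betw f {0..<n} J" using ex_bij_betw_nat_finite[OF J] c by (auto simp: n_def)
  define e' where "e' = inv_into {0..<n} e"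
  have e': "\<And>k. k < n \<Longrightarrow> e' (e k) = k"
    using e by (auto simp: e'_def bij_betw_def)
  define A where "A = mat n n (\<lambda>(r, k). a (e k) (f r))"
  have A: "A \<in> carrier_mat n n" by (simp add: A_def)
  have prod: "(A *\<^sub>v x) $ r = (\<Sum>i\<in>I. x $ e' i * a i (f r))" if "x \<in> carrier_vec n" "r < n" for x r
  proof -
    have "(A *\<^sub>v x) $ r = (\<Sum>k\<in>{0..<n}. x $ k * a (e k) (f r))"
      using that by (simp add: A_def scalar_prod_def mult.commute)
    also have "\<dots> = (\<Sum>k\<in>{0..<n}. x $ e' (e k) * a (e k) (f r))" by (simp add: e')
    also have "\<dots> = (\<Sum>i\<in>I. x $ e' i * a i (f r))" by (rule sum.reindex_bij_betw[OF e])
    finally show ?thesis .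
  qed
  have "det A \<noteq> 0"
  proof
    assume "det A = 0"
    then obtain x where x: "x \<in> carrier_vec n" "x \<noteq> 0\<^sub>v n" "A *\<^sub>v x = 0\<^sub>v n"
      using det_0_iff_vec_prod_zero[OF A] by blast
    have "(\<Sum>i\<in>I. x $ e' i * a i j) = 0" if "j \<in> J" for j
    proof -
      obtain r where "r \<in> {0..<n}" "j = f r" using f \<open>j \<in> J\<close> unfolding bij_betw_def by blast
      then show ?thesis using prod[OF x(1), of r] x(3) by simp
    qed
    then have "\<forall>i\<in>I. x $ e' i = 0" by (intro indep) auto
    then have "x $ k = 0" if "k < n" for k
      using e'[OF that] e that by (metis atLeast0LessThan bij_betw_apply lessThan_iff)
    then have "x = 0\<^sub>v n" using x(1) by (intro eq_vecI) auto
    then show False using x(2) by simp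
  qed
  from det_non_zero_imp_unit[OF A this, of "()"] obtain B where
    B: "B \<in> carrier_mat n n" "A * B = 1\<^sub>m n" by (auto simp: Units_def ring_mat_simps)
  define x where "x = B *\<^sub>v vec n (\<lambda>r. b (f r))"
  have x: "x \<in> carrier_vec n" using B by (simp add: x_def)
  have Ax: "A *\<^sub>v x = vec n (\<lambda>r. b (f r))"
    using assoc_mult_mat_vec[OF A B(1), of "vec n (\<lambda>r. b (f r))"] B(2) by (simp add: x_def)
  show ?thesis
  proof (intro exI ballI)
    fix j assume "j \<in> J"
    then obtain r where "r \<in> {0..<n}" "j = f r" using f unfolding bij_betw_def by blast
    then show "(\<Sum>i\<in>I. x $ e' i * a i j) = b j" using prod[OF x, of r] Ax by simp
  qed
qed

locale supercharacter_group = finite_order_group +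
  fixes S :: "'a sct"
  assumes sct: "supercharacter_theory G S"
begin

definition class_constant :: "('a \<Rightarrow> complex) \<Rightarrow> bool" where
  "class_constant f \<longleftrightarrow> (\<forall>K\<in>Cl S. \<forall>g\<in>K. \<forall>h\<in>K. f g = f h)"

lemma class_constantD: "class_constant f \<Longrightarrow> K \<in> Cl S \<Longrightarrow> g \<in> K \<Longrightarrow> h \<in> K \<Longrightarrow> f g = f h"
  unfolding class_constant_def by blast

lemma class_constant_indicator:
  assumes "\<And>K g h. K \<in> Cl S \<Longrightarrow> g \<in> K \<Longrightarrow> h \<in> K \<Longrightarrow> g \<in> A \<Longrightarrow> h \<in> A"
  shows "class_constant (\<lambda>y. if y \<in> A then 1 else 0)"
  unfolding class_constant_def
proof (intro ballI)
  fix K g h assume "K \<in> Cl S" "g \<in> K" "h \<in> K"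
  then have "g \<in> A \<longleftrightarrow> h \<in> A" using assms by blast
  then show "(if g \<in> A then 1 else 0 :: complex) = (if h \<in> A then 1 else 0)" by simp
qed

lemma Cl_partition: "partition_on (carrier G) (Cl S)"
  and Irr_partition: "partition_on (Irr G) (fst S)"
  and card_Cl: "card (Cl S) = card (fst S)"
  and one_in_Cl: "{\<one>} \<in> Cl S"
  using sct by (auto simp: supercharacter_theory_def Cl_def case_prod_beta)

lemma Cl_subset: "K \<in> Cl S \<Longrightarrow> K \<subseteq> carrier G"
  and Cl_nonempty: "K \<in> Cl S \<Longrightarrow> K \<noteq> {}"
  using Cl_partition by (auto simp: partition_on_def)

lemma Cl_eq: "K \<in> Cl S \<Longrightarrow> L \<in> Cl S \<Longrightarrow> x \<in> K \<Longrightarrow> x \<in> L \<Longrightarrow> K = L"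
  using Cl_partition by (auto simp: partition_on_def disjoint_def)

lemma Cl_cover: "x \<in> carrier G \<Longrightarrow> \<exists>K\<in>Cl S. x \<in> K"
  using Cl_partition by (auto simp: partition_on_def)

lemma finite_Cl: "finite (Cl S)"
  using finite_elements[OF finite_carrier Cl_partition] .

lemma finite_Irr_partition: "finite (fst S)"
  using card_Cl finite_Cl one_in_Cl by (metis card_gt_0_iff empty_iff)

text \<open>The \<open>\<xi> X\<close> are independent because their constituents lie in disjoint parts \<open>X\<close>. As there are as many
parts \<open>X\<close> as superclasses, their number is the dimension of the space of functions constant on
superclasses, and they span it. The multiset \<open>M X\<close> lists the constituents of \<open>\<xi> X\<close>.\<close>

lemma supercharacter_basis:
  obtains \<xi> :: "('a \<Rightarrow> complex) set \<Rightarrow> 'a \<Rightarrow> complex" and M :: "('a \<Rightarrow> complex) set \<Rightarrow> ('a \<Rightarrow> complex) multiset"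
  where "\<And>X. X \<in> fst S \<Longrightarrow> character G (\<xi> X)"
    and "\<And>X. X \<in> fst S \<Longrightarrow> class_constant (\<xi> X)"
    and "\<And>X. X \<in> fst S \<Longrightarrow> set_mset (M X) \<subseteq> Irr G"
    and "\<And>X g. X \<in> fst S \<Longrightarrow> g \<in> carrier G \<Longrightarrow> \<xi> X g = (\<Sum>\<chi>\<in>#M X. \<chi> g)"
    and "\<And>X Y \<chi>. X \<in> fst S \<Longrightarrow> Y \<in> fst S \<Longrightarrow> \<chi> \<in># M X \<Longrightarrow> \<chi> \<in># M Y \<Longrightarrow> X = Y"
    and "\<And>f. class_constant f \<Longrightarrow> \<exists>v. \<forall>g\<in>carrier G. f g = (\<Sum>X\<in>fst S. v X * \<xi> X g)"
proof -
  have "\<forall>X\<in>fst S. \<exists>\<xi>. character G \<xi> \<and> Irr_constituents G \<xi> \<subseteq> X \<and> class_constant \<xi>"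
    using sct by (auto simp: supercharacter_theory_def class_constant_def Cl_def case_prod_beta)
  then obtain \<xi> where xi: "\<forall>X\<in>fst S. character G (\<xi> X) \<and> Irr_constituents G (\<xi> X) \<subseteq> X \<and> class_constant (\<xi> X)"
    by (rule bchoice[THEN exE])
  have ch: "character G (\<xi> X)" and cc: "class_constant (\<xi> X)" if "X \<in> fst S" for X
    using xi that by auto
  have "\<forall>X\<in>fst S. \<exists>M. M \<noteq> {#} \<and> set_mset M \<subseteq> Irr_constituents G (\<xi> X) \<and>
      (\<forall>g\<in>carrier G. \<xi> X g = (\<Sum>\<chi>\<in>#M. \<chi> g))"
    using character_expansion ch by blast
  then obtain M where M: "\<forall>X\<in>fst S. M X \<noteq> {#} \<and> set_mset (M X) \<subseteq> Irr_constituents G (\<xi> X) \<and>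
      (\<forall>g\<in>carrier G. \<xi> X g = (\<Sum>\<chi>\<in>#M X. \<chi> g))"
    by (rule bchoice[THEN exE])
  have ne: "M X \<noteq> {#}" and sub: "set_mset (M X) \<subseteq> X" if X: "X \<in> fst S" for X
    using bspec[OF xi X] bspec[OF M X] by blast+
  have ex: "\<xi> X g = (\<Sum>\<chi>\<in>#M X. \<chi> g)" if X: "X \<in> fst S" and g: "g \<in> carrier G" for X g
    using bspec[OF M X] g by blast
  have irr: "set_mset (M X) \<subseteq> Irr G" if "X \<in> fst S" for X
    using sub[OF that] that Irr_partition by (auto simp: partition_on_def)
  have disj: "X = Y" if "X \<in> fst S" "Y \<in> fst S" "\<chi> \<in># M X" "\<chi> \<in># M Y" for X Y \<chi>
    using sub[OF that(1)] sub[OF that(2)] that disjointD[OF partition_onD2[OF Irr_partition] that(1,2)]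
    by blast
  \<comment> \<open>a function constant on superclasses is determined by its values at class representatives\<close>
  define rep where "rep K = (SOME x. x \<in> K)" for K :: "'a set"
  have rep: "rep K \<in> K" if "K \<in> Cl S" for K
    using Cl_nonempty[OF that] by (simp add: rep_def some_in_eq)
  have indep: "\<forall>X\<in>fst S. v X = 0" if v: "\<forall>K\<in>Cl S. (\<Sum>X\<in>fst S. v X * \<xi> X (rep K)) = 0" for v
  proof
    fix X assume X: "X \<in> fst S"
    obtain \<chi> where chi: "\<chi> \<in># M X" using ne[OF X] by auto
    have zero: "(\<Sum>Y\<in>fst S. v Y * \<xi> Y g) = 0" if g: "g \<in> carrier G" for g
    proof -
      obtain K where K: "K \<in> Cl S" "g \<in> K" using Cl_cover[OF g] by blast
      have "\<xi> Y g = \<xi> Y (rep K)" if "Y \<in> fst S" for Y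
        by (rule class_constantD[OF cc[OF that] K rep[OF K(1)]])
      then show ?thesis using v K by simp
    qed
    have "char_form (\<lambda>g. 0) \<chi> = v X * (of_nat (card (carrier G)) * of_nat (count (M X) \<chi>))"
    proof (rule pairing_extracts_coefficient[where M = M and \<xi> = \<xi>, OF finite_Irr_partition X chi irr ex])
      show "Y = X" if "Y \<in> fst S" "\<chi> \<in># M Y" for Y using disj[OF that(1) X that(2) chi] .
      show "0 = (\<Sum>Y\<in>fst S. v Y * \<xi> Y g)" if "g \<in> carrier G" for g using zero[OF that] by simp
    qed
    then show "v X = 0" using chi finite_carrier one_closed by (auto simp: char_form_def count_eq_zero_iff)
  qed
  have span: "\<exists>v. \<forall>g\<in>carrier G. f g = (\<Sum>X\<in>fst S. v X * \<xi> X g)" if f: "class_constant f" for f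
  proof -
    obtain v where v: "\<forall>K\<in>Cl S. (\<Sum>X\<in>fst S. v X * \<xi> X (rep K)) = f (rep K)"
      using square_system_solvable[OF finite_Irr_partition finite_Cl card_Cl[symmetric],
          of "\<lambda>X K. \<xi> X (rep K)" "\<lambda>K. f (rep K)"] indep by blast
    have "f g = (\<Sum>X\<in>fst S. v X * \<xi> X g)" if g: "g \<in> carrier G" for g
    proof -
      obtain K where K: "K \<in> Cl S" "g \<in> K" using Cl_cover[OF g] by blast
      have "\<xi> Y g = \<xi> Y (rep K)" if "Y \<in> fst S" for Y
        by (rule class_constantD[OF cc[OF that] K rep[OF K(1)]])
      moreover have "f g = f (rep K)" by (rule class_constantD[OF f K rep[OF K(1)]])
      ultimately show ?thesis using v K by simp
    qed
    then show ?thesis by blast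
  qed
  show ?thesis by (rule that[OF ch cc irr ex disj span])
qed

text \<open>The indicator function of a superclass is a combination of characters, hence a class function.\<close>

lemma Cl_conjugation_closed:
  assumes K: "K \<in> Cl S" and x: "x \<in> K" and g: "g \<in> carrier G"
  shows "g \<otimes> x \<otimes> inv g \<in> K"
proof (rule supercharacter_basis)
  fix \<xi> M
  assume ch: "\<And>X. X \<in> fst S \<Longrightarrow> character G (\<xi> X)"
    and span: "\<And>f. class_constant f \<Longrightarrow> \<exists>v. \<forall>g\<in>carrier G. f g = (\<Sum>X\<in>fst S. v X * \<xi> X g)"
  have xc: "x \<in> carrier G" using Cl_subset[OF K] x by blast
  let ?f = "\<lambda>y. if y \<in> K then 1 else 0 :: complex"
  have "class_constant ?f" using K Cl_eq by (intro class_constant_indicator) blast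
  then obtain v where v: "\<forall>g\<in>carrier G. ?f g = (\<Sum>X\<in>fst S. v X * \<xi> X g)" using span by blast
  have "\<xi> X (g \<otimes> x \<otimes> inv g) = \<xi> X x" if X: "X \<in> fst S" for X
  proof -
    have "\<xi> X (g \<otimes> (x \<otimes> inv g)) = \<xi> X ((x \<otimes> inv g) \<otimes> g)"
      using character_class_function[OF ch[OF X]] g xc by simp
    then show ?thesis using g xc by (simp add: m_assoc)
  qed
  then have "?f (g \<otimes> x \<otimes> inv g) = ?f x"
    using v g xc by simp
  then show ?thesis using x by (simp split: if_splits)
qed

lemma sct_normal_subset_class:
  assumes N: "sct_normal G S N" and K: "K \<in> Cl S" and x: "x \<in> K" "x \<in> N"
  shows "K \<subseteq> N"
proof -
  obtain C where C: "C \<subseteq> Cl S" "N = \<Union>C" using N by (auto simp: sct_normal_def)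
  then obtain L where "L \<in> C" "x \<in> L" using x by blast
  then show ?thesis using Cl_eq[OF K _ x(1)] C by blast
qed

lemma sct_normalI:
  assumes "subgroup N G" "\<And>K x. K \<in> Cl S \<Longrightarrow> x \<in> K \<Longrightarrow> x \<in> N \<Longrightarrow> K \<subseteq> N"
  shows "sct_normal G S N"
proof -
  have "N = \<Union>{K \<in> Cl S. K \<subseteq> N}"
  proof
    show "N \<subseteq> \<Union>{K \<in> Cl S. K \<subseteq> N}"
    proof
      fix x assume x: "x \<in> N"
      then obtain K where K: "K \<in> Cl S" "x \<in> K"
        using Cl_cover subgroup.mem_carrier[OF assms(1)] by blast
      then show "x \<in> \<Union>{K \<in> Cl S. K \<subseteq> N}" using assms(2)[OF K x] by blast
    qed
  qed blast
  then show ?thesis using assms(1) unfolding sct_normal_def by (intro conjI exI[of _ "{K \<in> Cl S. K \<subseteq> N}"]) auto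
qed

lemma sct_normal_Int:
  assumes "sct_normal G S N" "sct_normal G S M"
  shows "sct_normal G S (N \<inter> M)"
proof (rule sct_normalI)
  show "subgroup (N \<inter> M) G" using assms subgroups_Inter_pair by (auto simp: sct_normal_def)
qed (use assms sct_normal_subset_class in blast)

lemma sct_normal_imp_normal:
  assumes "sct_normal G S N"
  shows "N \<lhd> G"
  unfolding normal_inv_iff
proof (intro conjI ballI)
  show N: "subgroup N G" using assms by (simp add: sct_normal_def)
  fix g x assume g: "g \<in> carrier G" and x: "x \<in> N"
  then obtain K where K: "K \<in> Cl S" "x \<in> K" using Cl_cover subgroup.mem_carrier[OF N] by blast
  then show "g \<otimes> x \<otimes> inv g \<in> N"
    using sct_normal_subset_class[OF assms K x] Cl_conjugation_closed[OF K g] by blast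
qed

text \<open>Each \<open>\<xi> X\<close> is an eigenvector of the coset sum operator, although its constituents need not agree in
degree or multiplicity: the eigenvalue of a constituent \<open>\<chi>\<close> is nonzero iff \<open>\<chi>\<close> pairs nontrivially with
the indicator function of \<open>N\<close>, which happens iff that function has a nonzero coefficient \<open>w X\<close> at \<open>\<xi> X\<close>.\<close>

lemma coset_sum_class_constant:
  assumes N: "sct_normal G S N" and f: "class_constant f"
  shows "class_constant (coset_sum N f)"
proof (rule supercharacter_basis)
  fix \<xi> M
  assume cc: "\<And>X. X \<in> fst S \<Longrightarrow> class_constant (\<xi> X)"
    and irr: "\<And>X. X \<in> fst S \<Longrightarrow> set_mset (M X) \<subseteq> Irr G"
    and ex: "\<And>X g. X \<in> fst S \<Longrightarrow> g \<in> carrier G \<Longrightarrow> \<xi> X g = (\<Sum>\<chi>\<in>#M X. \<chi> g)"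
    and disj: "\<And>X Y \<chi>. X \<in> fst S \<Longrightarrow> Y \<in> fst S \<Longrightarrow> \<chi> \<in># M X \<Longrightarrow> \<chi> \<in># M Y \<Longrightarrow> X = Y"
    and span: "\<And>f. class_constant f \<Longrightarrow> \<exists>v. \<forall>g\<in>carrier G. f g = (\<Sum>X\<in>fst S. v X * \<xi> X g)"
  have nN: "N \<lhd> G" by (rule sct_normal_imp_normal[OF N])
  interpret N: normal N G by (rule nN)
  have finN: "finite N" using finite_subset[OF N.subset finite_carrier] .
  let ?i = "\<lambda>y. if y \<in> N then 1 else 0 :: complex"
  have "class_constant ?i"
    using sct_normal_subset_class[OF N] by (intro class_constant_indicator) blast
  then obtain w where "\<forall>g\<in>carrier G. ?i g = (\<Sum>X\<in>fst S. w X * \<xi> X g)" using span by blast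
  then have w: "\<And>g. g \<in> carrier G \<Longrightarrow> ?i g = (\<Sum>X\<in>fst S. w X * \<xi> X g)" by blast
  have key: "coset_sum N \<chi> \<one> = w X * (of_nat (card (carrier G)) * of_nat (count (M X) \<chi>))"
    if X: "X \<in> fst S" and chi: "\<chi> \<in># M X" for X \<chi>
  proof -
    have "coset_sum N \<chi> \<one> = (\<Sum>m\<in>N. \<chi> m)" by (simp add: coset_sum_def)
    also have "\<dots> = (\<Sum>m\<in>N. \<chi> (inv m))"
      by (rule sum.reindex_bij_witness[of _ "\<lambda>m. inv m" "\<lambda>m. inv m"]) auto
    also have "\<dots> = (\<Sum>g\<in>carrier G. ?i g * \<chi> (inv g))"
      using N.subset finite_carrier by (intro sum.mono_neutral_cong_left) auto
    also have "\<dots> = char_form ?i \<chi>" by (simp only: char_form_def)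
    also have "\<dots> = w X * (of_nat (card (carrier G)) * of_nat (count (M X) \<chi>))"
    proof (rule pairing_extracts_coefficient[where M = M and \<xi> = \<xi>, OF finite_Irr_partition X chi irr ex _ w])
      show "Y = X" if "Y \<in> fst S" "\<chi> \<in># M Y" for Y using disj[OF that(1) X that(2) chi] .
    qed
    finally show ?thesis .
  qed
  define c where "c X = (if w X = 0 then 0 else of_nat (card N) :: complex)" for X
  have chi: "coset_sum N \<chi> x = c X * \<chi> x" if X: "X \<in> fst S" and chi: "\<chi> \<in># M X" and x: "x \<in> carrier G" for X \<chi> x
  proof -
    have ch: "\<chi> \<in> Irr G" using irr[OF X] chi by blast
    have "card N \<noteq> 0" using finN N.one_closed by (metis card_eq_0_iff empty_iff)
    have "card (carrier G) \<noteq> 0" using finite_carrier one_closed by auto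
    show ?thesis
    proof (cases "w X = 0")
      case True
      then have "coset_sum N \<chi> \<one> = 0" using key[OF X chi] by simp
      then show ?thesis
        using coset_sum_Irr[OF ch nN] Irr_one_neq_zero[OF ch] \<open>card N \<noteq> 0\<close> x True
        by (auto simp: c_def)
    next
      case False
      then have "coset_sum N \<chi> \<one> \<noteq> 0"
        using key[OF X chi] chi \<open>card (carrier G) \<noteq> 0\<close> by auto
      then show ?thesis
        using coset_sum_Irr[OF ch nN] x False by (auto simp: c_def)
    qed
  qed
  have xi: "coset_sum N (\<xi> X) x = c X * \<xi> X x" if X: "X \<in> fst S" and x: "x \<in> carrier G" for X x
  proof -
    have "coset_sum N (\<xi> X) x = (\<Sum>m\<in>N. \<Sum>\<chi>\<in>#M X. \<chi> (x \<otimes> m))"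
      unfolding coset_sum_def using ex[OF X] x by (intro sum.cong) auto
    also have "\<dots> = (\<Sum>\<chi>\<in>#M X. coset_sum N \<chi> x)"
      unfolding coset_sum_def by (rule sum_sum_mset_swap)
    also have "\<dots> = (\<Sum>\<chi>\<in>#M X. c X * \<chi> x)"
      using chi[OF X _ x] by (intro arg_cong[of _ _ sum_mset] image_mset_cong) auto
    also have "\<dots> = c X * \<xi> X x" by (simp add: ex[OF X x] sum_mset_distrib_left image_mset.compositionality o_def)
    finally show ?thesis .
  qed
  obtain v where v: "\<forall>g\<in>carrier G. f g = (\<Sum>X\<in>fst S. v X * \<xi> X g)" using span[OF f] by blast
  have val: "coset_sum N f x = (\<Sum>X\<in>fst S. v X * (c X * \<xi> X x))" if x: "x \<in> carrier G" for x
  proof -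
    have "coset_sum N f x = (\<Sum>m\<in>N. \<Sum>X\<in>fst S. v X * \<xi> X (x \<otimes> m))"
      unfolding coset_sum_def using v x by (intro sum.cong) auto
    also have "\<dots> = (\<Sum>X\<in>fst S. v X * coset_sum N (\<xi> X) x)"
      unfolding coset_sum_def by (subst sum.swap) (simp add: sum_distrib_left)
    finally show ?thesis using xi x by simp
  qed
  show ?thesis
    unfolding class_constant_def
  proof (intro ballI)
    fix K g h assume K: "K \<in> Cl S" "g \<in> K" "h \<in> K"
    then have gh: "g \<in> carrier G" "h \<in> carrier G" using Cl_subset by blast+
    have "\<xi> X g = \<xi> X h" if "X \<in> fst S" for X by (rule class_constantD[OF cc[OF that] K])
    then show "coset_sum N f g = coset_sum N f h" by (simp add: val gh)
  qed
qed

text \<open>The coset sum of the indicator function of \<open>K\<close> counts the elements of \<open>K\<close> in a coset of \<open>N\<close>. It is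
constant on \<open>L\<close> and nonzero at \<open>y\<close>, so every coset that meets \<open>L\<close> meets \<open>K\<close>.\<close>

lemma coset_image_subset:
  assumes N: "sct_normal G S N" and K: "K \<in> Cl S" "x \<in> K" and L: "L \<in> Cl S" "y \<in> L"
    and eq: "N #> x = N #> y"
  shows "(\<lambda>x. N #> x) ` L \<subseteq> (\<lambda>x. N #> x) ` K"
proof
  interpret N: normal N G by (rule sct_normal_imp_normal[OF N])
  have finN: "finite N" using finite_subset[OF N.subset finite_carrier] .
  have xc: "x \<in> carrier G" and yc: "y \<in> carrier G" using K L Cl_subset by blast+
  let ?f = "\<lambda>y. if y \<in> K then 1 else 0 :: complex"
  have supp: "coset_sum N ?f z \<noteq> 0 \<longleftrightarrow> (\<exists>m\<in>N. z \<otimes> m \<in> K)" if "z \<in> carrier G" for z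
  proof -
    have "coset_sum N ?f z = of_nat (card {m \<in> N. z \<otimes> m \<in> K})"
      using finN by (simp add: coset_sum_def sum.If_cases Int_def)
    then show ?thesis using finN by auto
  qed
  have "class_constant ?f" using K Cl_eq by (intro class_constant_indicator) blast
  then have cc: "class_constant (coset_sum N ?f)" by (rule coset_sum_class_constant[OF N])
  have "x \<in> y <# N"
    using rcos_self[OF xc N.is_subgroup] eq N.coset_eq yc by auto
  then have "\<exists>m\<in>N. y \<otimes> m \<in> K" using K by (auto simp: l_coset_def)
  then have y0: "coset_sum N ?f y \<noteq> 0" using supp[OF yc] by simp
  fix C assume "C \<in> (\<lambda>x. N #> x) ` L"
  then obtain l where l: "l \<in> L" "C = N #> l" by blast
  have lc: "l \<in> carrier G" using l L Cl_subset by blast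
  have "coset_sum N ?f l = coset_sum N ?f y" by (rule class_constantD[OF cc L(1) l(1) L(2)])
  then obtain m where m: "m \<in> N" "l \<otimes> m \<in> K" using y0 supp[OF lc] by auto
  have "l \<otimes> m \<in> l <# N" using m by (auto simp: l_coset_def)
  then have "l \<otimes> m \<in> N #> l" using N.coset_eq lc by simp
  then have "N #> l = N #> (l \<otimes> m)" by (rule repr_independence[OF _ lc N.is_subgroup])
  then show "C \<in> (\<lambda>x. N #> x) ` K" using m l by blast
qed

lemma coset_image_eq:
  assumes "sct_normal G S N" "K \<in> Cl S" "x \<in> K" "L \<in> Cl S" "y \<in> L" "N #> x = N #> y"
  shows "(\<lambda>x. N #> x) ` K = (\<lambda>x. N #> x) ` L"
  using coset_image_subset[OF assms(1-6)] coset_image_subset[OF assms(1,4,5,2,3) assms(6)[symmetric]] by blast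

end

section \<open>Chief factors and the butterfly argument\<close>

lemma (in group) rcos_eq_iff:
  assumes "subgroup H G" "x \<in> carrier G" "y \<in> carrier G"
  shows "H #> x = H #> y \<longleftrightarrow> x \<otimes> inv y \<in> H"
proof
  assume "H #> x = H #> y"
  then have "x \<in> H #> y" using rcos_self[OF assms(2,1)] by simp
  then obtain h where "h \<in> H" "x = h \<otimes> y" by (auto simp: r_coset_def)
  then show "x \<otimes> inv y \<in> H"
    using assms subgroup.mem_carrier[OF assms(1)] by (simp add: m_assoc)
next
  assume h: "x \<otimes> inv y \<in> H"
  have "x = (x \<otimes> inv y) \<otimes> y" using assms by (simp add: m_assoc)
  then have "x \<in> H #> y" using h unfolding r_coset_def by blast
  then show "H #> x = H #> y" using repr_independence[OF _ assms(3,1)] by simp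
qed

lemma section_group_simps:
  "carrier (section_group G L M) = (\<lambda>x. M #>\<^bsub>G\<^esub> x) ` L"
  "monoid.mult (section_group G L M) = (<#>\<^bsub>G\<^esub>)"
  "one (section_group G L M) = M"
  by (auto simp: FactGroup_def RCOSETS_def r_coset_def set_mult_def fun_eq_iff)

lemma Cl_induced_sct: "Cl (induced_sct G S L M) = section_classes G S L M"
  by (simp add: Cl_def induced_sct_def)

context supercharacter_group
begin

definition chief_factor :: "'a set \<Rightarrow> 'a set \<Rightarrow> bool" where
  "chief_factor A B \<longleftrightarrow> sct_normal G S A \<and> sct_normal G S B \<and> B \<subseteq> A \<and>
     sct_simple (section_group G A B) (induced_sct G S A B)"

definition covers :: "'a set \<Rightarrow> 'a set \<Rightarrow> 'a set \<Rightarrow> bool" where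
  "covers Q A B \<longleftrightarrow> Q \<subseteq> A \<and> (\<forall>a\<in>A. \<exists>q\<in>Q. B #> a = B #> q)"

lemma sct_normal_subgroup: "sct_normal G S N \<Longrightarrow> subgroup N G"
  by (simp add: sct_normal_def)

text \<open>The image of \<open>Q\<close> in \<open>A/B\<close> is a subgroup and the union of the images of the superclasses inside \<open>Q\<close>, so
simplicity makes it trivial or everything.\<close>

lemma chief_factor_dichotomy:
  assumes chief: "chief_factor A B" and Q: "sct_normal G S Q" "Q \<subseteq> A"
  shows "Q \<subseteq> B \<or> covers Q A B"
proof -
  have A: "sct_normal G S A" and B: "sct_normal G S B" and BA: "B \<subseteq> A"
    and simple: "sct_simple (section_group G A B) (induced_sct G S A B)"
    using chief by (auto simp: chief_factor_def)
  note sA = sct_normal_subgroup[OF A] and sB = sct_normal_subgroup[OF B] and sQ = sct_normal_subgroup[OF Q(1)]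
  let ?\<pi> = "\<lambda>x. B #> x"
  let ?A = "G\<lparr>carrier := A\<rparr>"
  have nB: "B \<lhd> ?A"
    by (rule normal_restrict_supergroup[OF sA sct_normal_imp_normal[OF B] BA])
  interpret B: normal B ?A by (rule nB)
  have "?\<pi> = (\<lambda>x. B #>\<^bsub>?A\<^esub> x)" by (simp add: r_coset_def fun_eq_iff)
  then have hom: "?\<pi> \<in> hom ?A (section_group G A B)" using B.r_coset_hom_Mod by simp
  interpret \<pi>: group_hom ?A "section_group G A B" ?\<pi>
    by (intro group_hom.intro group_hom_axioms.intro subgroup_imp_group[OF sA] B.factorgroup_is_group hom)
  have "subgroup Q ?A" by (rule subgroup_incl[OF sQ sA Q(2)])
  then have "subgroup (?\<pi> ` Q) (section_group G A B)" by (rule \<pi>.subgroup_img_is_subgroup)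
  moreover have "?\<pi> ` Q = \<Union>{?\<pi> ` K | K. K \<in> Cl S \<and> K \<subseteq> Q}"
  proof
    show "?\<pi> ` Q \<subseteq> \<Union>{?\<pi> ` K | K. K \<in> Cl S \<and> K \<subseteq> Q}"
    proof
      fix C assume "C \<in> ?\<pi> ` Q"
      then obtain q where q: "q \<in> Q" "C = B #> q" by blast
      then obtain K where K: "K \<in> Cl S" "q \<in> K" using Cl_cover subgroup.mem_carrier[OF sQ] by blast
      then have "K \<subseteq> Q" using sct_normal_subset_class[OF Q(1)] q by blast
      then show "C \<in> \<Union>{?\<pi> ` K | K. K \<in> Cl S \<and> K \<subseteq> Q}" using K q by blast
    qed
  qed blast
  moreover have "{?\<pi> ` K | K. K \<in> Cl S \<and> K \<subseteq> Q} \<subseteq> Cl (induced_sct G S A B)"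
    using Q(2) by (auto simp: Cl_induced_sct section_classes_def)
  ultimately have "sct_normal (section_group G A B) (induced_sct G S A B) (?\<pi> ` Q)"
    unfolding sct_normal_def by blast
  then have "?\<pi> ` Q = {B} \<or> ?\<pi> ` Q = ?\<pi> ` A"
    using simple unfolding sct_simple_def section_group_simps by blast
  then show ?thesis
  proof
    assume triv: "?\<pi> ` Q = {B}"
    have "q \<in> B" if "q \<in> Q" for q
    proof -
      have "B #> q = B" using triv that by blast
      then show ?thesis using rcos_self[OF subgroup.mem_carrier[OF sQ that] sB] by simp
    qed
    then show ?thesis by blast
  next
    assume full: "?\<pi> ` Q = ?\<pi> ` A"
    have "\<exists>q\<in>Q. B #> a = B #> q" if "a \<in> A" for a
    proof -
      have "B #> a \<in> ?\<pi> ` Q" unfolding full using that by (rule imageI)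
      then show ?thesis by (rule imageE) blast
    qed
    then show ?thesis using Q(2) by (simp add: covers_def)
  qed
qed

text \<open>A superclass in \<open>A\<close> shares a coset of \<open>B\<close> with some element of \<open>Q\<close>, and then has the same image in \<open>A/B\<close>
as the superclass of that element, which stays inside \<open>Q\<close>.\<close>

lemma section_classes_covers:
  assumes A: "sct_normal G S A" and B: "sct_normal G S B" and Q: "sct_normal G S Q" and cov: "covers Q A B"
  shows "section_classes G S A B = {(\<lambda>x. B #> x) ` K | K. K \<in> Cl S \<and> K \<subseteq> Q}"
proof
  show "section_classes G S A B \<subseteq> {(\<lambda>x. B #> x) ` K | K. K \<in> Cl S \<and> K \<subseteq> Q}"
  proof
    fix C assume "C \<in> section_classes G S A B"
    then obtain K where K: "K \<in> Cl S" "K \<subseteq> A" "C = (\<lambda>x. B #> x) ` K"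
      by (auto simp: section_classes_def)
    then obtain a where a: "a \<in> K" using Cl_nonempty by blast
    then obtain q where q: "q \<in> Q" "B #> a = B #> q" using cov K(2) unfolding covers_def by blast
    then obtain L where L: "L \<in> Cl S" "q \<in> L"
      using Cl_cover subgroup.mem_carrier[OF sct_normal_subgroup[OF Q]] by blast
    have "C = (\<lambda>x. B #> x) ` L" unfolding K(3) by (rule coset_image_eq[OF B K(1) a L q(2)])
    moreover have "L \<subseteq> Q" by (rule sct_normal_subset_class[OF Q L q(1)])
    ultimately show "C \<in> {(\<lambda>x. B #> x) ` K | K. K \<in> Cl S \<and> K \<subseteq> Q}" using L by blast
  qed
  show "{(\<lambda>x. B #> x) ` K | K. K \<in> Cl S \<and> K \<subseteq> Q} \<subseteq> section_classes G S A B"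
    using cov unfolding section_classes_def covers_def by blast
qed

text \<open>Both quotients are \<open>Q/(Q \<inter> B)\<close> by the second isomorphism theorem; the isomorphism sends \<open>B #> q\<close> to
\<open>D #> q\<close> for \<open>q \<in> Q\<close>, and on both sides the classes are the images of the superclasses inside \<open>Q\<close>.\<close>

lemma sections_isomorphic_via_common_cover:
  assumes A: "sct_normal G S A" and B: "sct_normal G S B"
    and C: "sct_normal G S C" and D: "sct_normal G S D" and Q: "sct_normal G S Q"
    and covAB: "covers Q A B" and covCD: "covers Q C D" and meet: "Q \<inter> B = Q \<inter> D"
  shows "\<exists>\<phi>. \<phi> \<in> iso (section_group G A B) (section_group G C D) \<and>
    sct_iso_via \<phi> (induced_sct G S A B) (induced_sct G S C D)"
proof -
  interpret B: normal B G by (rule sct_normal_imp_normal[OF B])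
  interpret D: normal D G by (rule sct_normal_imp_normal[OF D])
  interpret Q: subgroup Q G by (rule sct_normal_subgroup[OF Q])
  have eq: "B #> p = B #> q \<longleftrightarrow> D #> p = D #> q" if "p \<in> Q" "q \<in> Q" for p q
    using that meet rcos_eq_iff[OF B.is_subgroup, of p q] rcos_eq_iff[OF D.is_subgroup, of p q]
    by (metis IntD2 IntI Q.m_closed Q.m_inv_closed Q.mem_carrier)
  define \<phi> where "\<phi> X = D #> (SOME q. q \<in> Q \<and> X = B #> q)" for X
  have phi: "\<phi> (B #> q) = D #> q" if q: "q \<in> Q" for q
  proof -
    let ?p = "SOME p. p \<in> Q \<and> B #> q = B #> p"
    have "?p \<in> Q \<and> B #> q = B #> ?p" by (rule someI[of _ q]) (simp add: q)
    then show ?thesis using eq[of q ?p] q by (simp add: \<phi>_def)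
  qed
  have carAB: "carrier (section_group G A B) = (\<lambda>q. B #> q) ` Q"
    using covAB unfolding section_group_simps covers_def by blast
  have carCD: "carrier (section_group G C D) = (\<lambda>q. D #> q) ` Q"
    using covCD unfolding section_group_simps covers_def by blast
  have "\<phi> \<in> hom (section_group G A B) (section_group G C D)"
  proof (rule homI)
    show "\<phi> X \<in> carrier (section_group G C D)" if "X \<in> carrier (section_group G A B)" for X
      using that phi by (auto simp: carAB carCD)
    show "\<phi> (X \<otimes>\<^bsub>section_group G A B\<^esub> Y) = \<phi> X \<otimes>\<^bsub>section_group G C D\<^esub> \<phi> Y"
      if XY: "X \<in> carrier (section_group G A B)" "Y \<in> carrier (section_group G A B)" for X Y
    proof -
      obtain p q where pq: "p \<in> Q" "q \<in> Q" "X = B #> p" "Y = B #> q" using XY by (auto simp: carAB)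
      then show ?thesis
        unfolding section_group_simps(2) by (simp add: B.rcos_sum D.rcos_sum phi)
    qed
  qed
  moreover have "bij_betw \<phi> (carrier (section_group G A B)) (carrier (section_group G C D))"
    unfolding bij_betw_def carAB carCD
  proof
    show "inj_on \<phi> ((\<lambda>q. B #> q) ` Q)" using eq by (auto simp: inj_on_def phi)
    show "\<phi> ` (\<lambda>q. B #> q) ` Q = (\<lambda>q. D #> q) ` Q" by (simp add: image_image phi)
  qed
  moreover have "sct_iso_via \<phi> (induced_sct G S A B) (induced_sct G S C D)"
    unfolding sct_iso_via_def Cl_induced_sct section_classes_covers[OF A B Q covAB]
      section_classes_covers[OF C D Q covCD]
  proof -
    have im: "\<phi> ` (\<lambda>x. B #> x) ` K = (\<lambda>x. D #> x) ` K" if "K \<subseteq> Q" for K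
      unfolding image_image using that phi by (intro image_cong) auto
    show "{(\<lambda>x. D #> x) ` K | K. K \<in> Cl S \<and> K \<subseteq> Q} =
        {\<phi> ` L | L. L \<in> {(\<lambda>x. B #> x) ` K | K. K \<in> Cl S \<and> K \<subseteq> Q}}" (is "?L = ?R")
    proof
      show "?L \<subseteq> ?R"
      proof
        fix X assume "X \<in> ?L"
        then obtain K where K: "K \<in> Cl S" "K \<subseteq> Q" "X = (\<lambda>x. D #> x) ` K" by blast
        then have "X = \<phi> ` (\<lambda>x. B #> x) ` K" using im by simp
        then show "X \<in> ?R" using K by blast
      qed
      show "?R \<subseteq> ?L"
      proof
        fix X assume "X \<in> ?R"
        then obtain K where K: "K \<in> Cl S" "K \<subseteq> Q" "X = \<phi> ` (\<lambda>x. B #> x) ` K" by blast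
        then have "X = (\<lambda>x. D #> x) ` K" using im by simp
        then show "X \<in> ?L" using K by blast
      qed
    qed
  qed
  ultimately show ?thesis by (auto simp: iso_def)
qed

text \<open>The first two conclusions are the hypotheses with \<open>A/B\<close> and \<open>C/D\<close> exchanged. For the second, if \<open>B \<inter> C\<close>
were not in \<open>D\<close> it would cover \<open>C/D\<close>; any element of \<open>A \<inter> C\<close> would then differ from one of \<open>B \<inter> C\<close> by
an element of \<open>A \<inter> D \<subseteq> B\<close>, forcing \<open>A \<inter> C \<subseteq> B\<close>.\<close>

lemma chief_factors_linked:
  assumes AB: "chief_factor A B" and CD: "chief_factor C D"
    and notin: "\<not> A \<inter> C \<subseteq> B" and sub: "A \<inter> D \<subseteq> B"
  shows "\<not> A \<inter> C \<subseteq> D" "B \<inter> C \<subseteq> D" "covers (A \<inter> C) A B" "covers (A \<inter> C) C D"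
proof -
  have n: "sct_normal G S A" "sct_normal G S B" "sct_normal G S C" "sct_normal G S D" and BA: "B \<subseteq> A"
    using AB CD by (auto simp: chief_factor_def)
  show nD: "\<not> A \<inter> C \<subseteq> D" using notin sub by blast
  show "covers (A \<inter> C) A B"
    using chief_factor_dichotomy[OF AB sct_normal_Int[OF n(1,3)]] notin by blast
  show "covers (A \<inter> C) C D"
    using chief_factor_dichotomy[OF CD sct_normal_Int[OF n(1,3)]] nD by blast
  have "\<not> covers (B \<inter> C) C D"
  proof
    assume cov: "covers (B \<inter> C) C D"
    interpret A: subgroup A G by (rule sct_normal_subgroup[OF n(1)])
    interpret B: subgroup B G by (rule sct_normal_subgroup[OF n(2)])
    have "q \<in> B" if q: "q \<in> A \<inter> C" for q
    proof -
      obtain r where r: "r \<in> B" "D #> q = D #> r" using cov q by (auto simp: covers_def)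
      then have rA: "r \<in> A" using BA by blast
      have "q \<otimes> inv r \<in> D"
        using rcos_eq_iff[OF sct_normal_subgroup[OF n(4)], of q r] r rA q by auto
      moreover have "q \<otimes> inv r \<in> A" using q rA by auto
      ultimately have "q \<otimes> inv r \<in> B" using sub by blast
      then have "q \<otimes> inv r \<otimes> r \<in> B" using r by blast
      then show ?thesis using q rA by (simp add: m_assoc)
    qed
    then show False using notin by blast
  qed
  then show "B \<inter> C \<subseteq> D"
    using chief_factor_dichotomy[OF CD sct_normal_Int[OF n(2,3)]] by blast
qed

lemma sct_chief_seriesD:
  assumes "sct_chief_series G S s N"
  shows "N 1 = carrier G" "N s = {\<one>}" "1 \<le> s"
    and "\<And>i. i \<in> {1..s - 1} \<Longrightarrow> chief_factor (N i) (N (i + 1))"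
    and "\<And>i. i \<in> {1..s - 1} \<Longrightarrow> N (i + 1) \<subset> N i"
    and "\<And>i. i \<in> {1..s} \<Longrightarrow> sct_normal G S (N i)"
proof -
  show "chief_factor (N i) (N (i + 1))" if "i \<in> {1..s - 1}" for i
  proof -
    have "i \<in> {1..s}" "i + 1 \<in> {1..s}" using that by auto
    then show ?thesis using assms that unfolding sct_chief_series_def chief_factor_def by blast
  qed
qed (use assms in \<open>auto simp: sct_chief_series_def\<close>)

lemma sct_chief_series_antimono:
  assumes N: "sct_chief_series G S s N" and ij: "1 \<le> i" "i \<le> j" "j \<le> s"
  shows "N j \<subseteq> N i"
  using ij(2,3)
proof (induction j rule: dec_induct)
  case (step k)
  then have "k \<in> {1..s - 1}" using ij by auto
  then show ?case using sct_chief_seriesD(5)[OF N, of k] step by auto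
qed simp

lemma exists_linked_index:
  assumes N: "sct_chief_series G S s N" and H: "sct_chief_series G S s H" and i: "i \<in> {1..s - 1}"
  shows "\<exists>j\<in>{1..s - 1}. \<not> N i \<inter> H j \<subseteq> N (i + 1) \<and> N i \<inter> H (j + 1) \<subseteq> N (i + 1)"
proof -
  let ?P = "\<lambda>k. N i \<inter> H (k + 1) \<subseteq> N (i + 1)"
  have i': "i \<in> {1..s}" "i + 1 \<in> {1..s}" using i by auto
  note sub = sct_chief_seriesD(6)[OF N i'(1), THEN sct_normal_subgroup]
    sct_chief_seriesD(6)[OF N i'(2), THEN sct_normal_subgroup]
  have start: "\<not> ?P 0"
    using sct_chief_seriesD(5)[OF N i] sct_chief_seriesD(1)[OF H] subgroup.subset[OF sub(1)] by auto
  have last: "?P (s - 1)"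
    using sct_chief_seriesD(2,3)[OF H] subgroup.one_closed[OF sub(2)] by auto
  obtain k where k: "k < s - 1" "\<forall>l\<le>k. \<not> ?P l" "?P (k + 1)"
    using ex_least_nat_less[of ?P "s - 1", OF last start] by auto
  have "\<not> ?P k" using k(2) by blast
  moreover have "k + 1 \<in> {1..s - 1}" using k(1) by simp
  ultimately show ?thesis using k(3) by blast
qed

end

theorem theorem2:
  fixes G :: "('a, 'b) monoid_scheme"
    and S :: "'a sct"
    and N H :: "nat \<Rightarrow> 'a set"
    and s :: nat
  assumes "group G"
    and "finite (carrier G)"
    and "supercharacter_theory G S"
    and "sct_chief_series G S s N"
    and "sct_chief_series G S s H"
  shows "\<exists>\<tau> \<phi>. \<tau> permutes {1..s - 1} \<and>
    (\<forall>i \<in> {1..s - 1}.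
       \<phi> i \<in> iso (section_group G (N i) (N (i + 1))) (section_group G (H (\<tau> i)) (H (\<tau> i + 1))) \<and>
       sct_iso_via (\<phi> i) (induced_sct G S (N i) (N (i + 1)))
                         (induced_sct G S (H (\<tau> i)) (H (\<tau> i + 1))))"
proof -
  interpret supercharacter_group G S
    using assms(1-3)
    by (simp add: supercharacter_group_def supercharacter_group_axioms_def
        finite_order_group_def finite_order_group_axioms_def)
  note N = assms(4) and H = assms(5)
  let ?I = "{1..s - 1}"
  obtain t where t: "\<forall>i\<in>?I. t i \<in> ?I \<and> \<not> N i \<inter> H (t i) \<subseteq> N (i + 1) \<and> N i \<inter> H (t i + 1) \<subseteq> N (i + 1)"
    using exists_linked_index[OF N H] bchoice[of ?I "\<lambda>i j. j \<in> ?I \<and> \<not> N i \<inter> H j \<subseteq> N (i + 1) \<and> N i \<inter> H (j + 1) \<subseteq> N (i + 1)"]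
    by blast
  have linked: "\<not> N i \<inter> H (t i) \<subseteq> H (t i + 1)" "N (i + 1) \<inter> H (t i) \<subseteq> H (t i + 1)"
    "covers (N i \<inter> H (t i)) (N i) (N (i + 1))" "covers (N i \<inter> H (t i)) (H (t i)) (H (t i + 1))"
    if i: "i \<in> ?I" for i
    using chief_factors_linked[OF sct_chief_seriesD(4)[OF N i] sct_chief_seriesD(4)[OF H, of "t i"]] t i
    by blast+
  \<comment> \<open>a common link \<open>j\<close> of \<open>i < i'\<close> would give \<open>N i' \<inter> H j \<subseteq> N (i + 1) \<inter> H j \<subseteq> H (j + 1)\<close>\<close>
  have less: "t i \<noteq> t i'" if "i \<in> ?I" "i' \<in> ?I" "i < i'" for i i'
  proof
    assume eq: "t i = t i'"
    have "N i' \<subseteq> N (i + 1)" using that by (intro sct_chief_series_antimono[OF N]) auto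
    then show False using linked(1)[OF that(2)] linked(2)[OF that(1)] eq by auto
  qed
  have "inj_on t ?I"
    using less by (intro inj_onI) (metis linorder_neqE_nat)
  moreover have "t ` ?I \<subseteq> ?I" using t by blast
  ultimately have bij: "bij_betw t ?I ?I"
    by (simp add: bij_betw_def endo_inj_surj)
  define \<tau> where "\<tau> i = (if i \<in> ?I then t i else i)" for i
  have "bij_betw \<tau> ?I ?I" using bij bij_betw_cong[of ?I \<tau> t ?I] by (simp add: \<tau>_def)
  then have perm: "\<tau> permutes ?I" by (rule bij_imp_permutes) (auto simp: \<tau>_def)
  have "\<exists>\<phi>. \<phi> \<in> iso (section_group G (N i) (N (i + 1))) (section_group G (H (\<tau> i)) (H (\<tau> i + 1))) \<and>
       sct_iso_via \<phi> (induced_sct G S (N i) (N (i + 1))) (induced_sct G S (H (\<tau> i)) (H (\<tau> i + 1)))"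
    if i: "i \<in> ?I" for i
  proof -
    have ti: "t i \<in> ?I" and sub: "N i \<inter> H (t i + 1) \<subseteq> N (i + 1)" using t i by blast+
    have n: "sct_normal G S (N i)" "sct_normal G S (N (i + 1))"
      "sct_normal G S (H (t i))" "sct_normal G S (H (t i + 1))"
      using sct_chief_seriesD(4)[OF N i] sct_chief_seriesD(4)[OF H ti] by (auto simp: chief_factor_def)
    have "N i \<inter> H (t i) \<inter> N (i + 1) = N i \<inter> H (t i) \<inter> H (t i + 1)"
      using sub linked(2)[OF i] by blast
    then show ?thesis
      using sections_isomorphic_via_common_cover[OF n sct_normal_Int[OF n(1,3)] linked(3,4)[OF i]] i
      by (simp add: \<tau>_def)
  qed
  then obtain \<phi> where "\<forall>i\<in>?I. \<phi> i \<in> iso (section_group G (N i) (N (i + 1))) (section_group G (H (\<tau> i)) (H (\<tau> i + 1))) \<and>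
       sct_iso_via (\<phi> i) (induced_sct G S (N i) (N (i + 1))) (induced_sct G S (H (\<tau> i)) (H (\<tau> i + 1)))"
    using bchoice[of ?I "\<lambda>i \<phi>. \<phi> \<in> iso (section_group G (N i) (N (i + 1))) (section_group G (H (\<tau> i)) (H (\<tau> i + 1))) \<and>
       sct_iso_via \<phi> (induced_sct G S (N i) (N (i + 1))) (induced_sct G S (H (\<tau> i)) (H (\<tau> i + 1)))"]
    by blast
  then show ?thesis using perm by blast
qed

end
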